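(* Let $\operatorname{Homeo}(\mathbb Q)$ be equipped with a group topology such that the evaluation map $\mathbb Q\times\operatorname{Homeo}(\mathbb Q)\to\mathbb Q$, $(q,h)\mapsto (q)h$, is continuous when $\mathbb Q$ is given its usual topology. Then $\operatorname{Homeo}(\mathbb Q)$ has: (1) at least $\mathfrak c$ open maximal subgroups; (2) exactly $2^{\mathfrak c}$ closed maximal subgroups.
   Context: $\operatorname{Homeo}(\mathbb Q)$ is the group of all homeomorphisms of $\mathbb Q$ with its usual topology; maps are written on the right. A group topology is one making multiplication and inversion continuous. A proper subgroup $M$ of a group $G$ is maximal if there is no subgroup $H$ of $G$ with $M<H<G$. An open (closed) maximal subgroup is a maximal subgroup that is an open (closed) subset in the given topology. $\mathfrak c=2^{\aleph_0}$. *)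

theory Defs
  imports "HOL-Analysis.Analysis" "HOL-Algebra.Group"
begin

(* Type rat carries no topology in the library; its usual topology is the one
   induced by the embedding into the reals. *)
definition rat_topology :: "rat topology" where
  "rat_topology = pullback_topology UNIV (of_rat :: rat \<Rightarrow> real) euclidean"

lemma topspace_rat_topology [simp]: "topspace rat_topology = UNIV"
  by (simp add: rat_topology_def topspace_pullback_topology)

(* Maps act on the right, so the product of f and g is "first f, then g". *)
definition Homeo_group :: "'a topology \<Rightarrow> ('a \<Rightarrow> 'a) monoid" where
  "Homeo_group X =
     \<lparr>carrier = {f \<in> extensional (topspace X). homeomorphic_map X X f},
      mult = (\<lambda>f g. compose (topspace X) g f),
      one = restrict id (topspace X)\<rparr>"

abbreviation Homeo_Q :: "(rat \<Rightarrow> rat) monoid" where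
  "Homeo_Q \<equiv> Homeo_group rat_topology"

lemma group_Homeo_group: "group (Homeo_group X)"
proof (rule groupI)
  fix f g assume fg: "f \<in> carrier (Homeo_group X)" "g \<in> carrier (Homeo_group X)"
  then have "homeomorphic_map X X (g \<circ> f)"
    by (auto simp: Homeo_group_def intro: homeomorphic_map_compose)
  then show "f \<otimes>\<^bsub>Homeo_group X\<^esub> g \<in> carrier (Homeo_group X)"
    by (auto simp: Homeo_group_def compose_def elim!: homeomorphic_map_eq)
next
  show "\<one>\<^bsub>Homeo_group X\<^esub> \<in> carrier (Homeo_group X)"
    using homeomorphic_map_eq[OF homeomorphic_map_id[THEN iffD2, OF refl], of X "restrict id (topspace X)"]
    by (auto simp: Homeo_group_def)
next
  fix f g h
  assume "f \<in> carrier (Homeo_group X)" "g \<in> carrier (Homeo_group X)" "h \<in> carrier (Homeo_group X)"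
  then show "f \<otimes>\<^bsub>Homeo_group X\<^esub> g \<otimes>\<^bsub>Homeo_group X\<^esub> h =
             f \<otimes>\<^bsub>Homeo_group X\<^esub> (g \<otimes>\<^bsub>Homeo_group X\<^esub> h)"
    using homeomorphic_imp_surjective_map[of X X f]
    by (auto simp: Homeo_group_def compose_def fun_eq_iff)
next
  fix f assume "f \<in> carrier (Homeo_group X)"
  then show "\<one>\<^bsub>Homeo_group X\<^esub> \<otimes>\<^bsub>Homeo_group X\<^esub> f = f"
    by (auto simp: Homeo_group_def compose_def fun_eq_iff extensional_def)
next
  fix f assume f: "f \<in> carrier (Homeo_group X)"
  then obtain g where g: "homeomorphic_maps X X f g"
    by (auto simp: Homeo_group_def homeomorphic_map_maps)
  define g' where "g' = restrict g (topspace X)"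
  have "homeomorphic_map X X g"
    using g homeomorphic_maps_map homeomorphic_maps_sym by blast
  then have "g' \<in> carrier (Homeo_group X)"
    by (auto simp: Homeo_group_def g'_def elim!: homeomorphic_map_eq)
  moreover have "g' \<otimes>\<^bsub>Homeo_group X\<^esub> f = \<one>\<^bsub>Homeo_group X\<^esub>"
    using g by (auto simp: Homeo_group_def g'_def compose_def fun_eq_iff homeomorphic_maps_def)
  ultimately show "\<exists>y\<in>carrier (Homeo_group X). y \<otimes>\<^bsub>Homeo_group X\<^esub> f = \<one>\<^bsub>Homeo_group X\<^esub>"
    by blast
qed

lemma carrier_Homeo_Q: "carrier Homeo_Q = {f. homeomorphic_map rat_topology rat_topology f}"
  and mult_Homeo_Q: "f \<otimes>\<^bsub>Homeo_Q\<^esub> g = g \<circ> f"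
  and one_Homeo_Q: "\<one>\<^bsub>Homeo_Q\<^esub> = id"
  by (auto simp: Homeo_group_def compose_def fun_eq_iff)

(* No separation axiom is imposed. *)
definition group_topology :: "('a, 'b) monoid_scheme \<Rightarrow> 'a topology \<Rightarrow> bool" where
  "group_topology G T \<longleftrightarrow>
     group G \<and> topspace T = carrier G \<and>
     continuous_map (prod_topology T T) T (\<lambda>(x, y). x \<otimes>\<^bsub>G\<^esub> y) \<and>
     continuous_map T T (\<lambda>x. inv\<^bsub>G\<^esub> x)"

definition maximal_subgroup :: "'a set \<Rightarrow> ('a, 'b) monoid_scheme \<Rightarrow> bool" where
  "maximal_subgroup M G \<longleftrightarrow>
     subgroup M G \<and> M \<noteq> carrier G \<and> \<not> (\<exists>H. subgroup H G \<and> M \<subset> H \<and> H \<subset> carrier G)"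

end

theory Submission
  imports Defs
begin

text \<open>
  By Cantor's theorem all nonempty open subsets of the rationals are homeomorphic, so the group acts
  very homogeneously on clopen sets. Two consequences carry the proof. If clopen sets \<open>A\<close> and \<open>B\<close>
  meet, then the homeomorphisms supported in \<open>A\<close> and those supported in \<open>B\<close> generate all those
  supported in \<open>A \<union> B\<close>. And in any group topology with continuous evaluation, the setwise
  stabilizer of a clopen set is open: a neighbourhood of the identity keeps each piece of a finite
  clopen partition off each other piece.

  By the first fact, the stabilizers of two distinct partitions \<open>{A, - A}\<close>, and those of two distinct
  ultrafilters of clopen sets, generate the whole group; hence each such stabilizer is maximal and
  determines the partition or the ultrafilter. By the second fact, the former are open and the
  latter are closed. An independent family of continuum many clopen sets yields continuum many
  partitions and \<open>2\<^sup>c\<close> ultrafilters (\<open>c\<close> the continuum), and there are only \<open>2\<^sup>c\<close> subsets of the group.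
\<close>

subsection \<open>Cantor's isomorphism theorem\<close>

text \<open>These are the orders isomorphic to the rationals. The notion is relative to a subset, so
  that it applies to open sets of rationals with the induced order.\<close>

definition countable_dense_unbounded :: "'a::linorder set \<Rightarrow> bool" where
  "countable_dense_unbounded U \<longleftrightarrow> U \<noteq> {} \<and> countable U \<and> (\<forall>x\<in>U. \<exists>y\<in>U. y < x) \<and> (\<forall>x\<in>U. \<exists>y\<in>U. x < y) \<and>
     (\<forall>x\<in>U. \<forall>y\<in>U. x < y \<longrightarrow> (\<exists>z\<in>U. x < z \<and> z < y))"

text \<open>A relation instead of a function keeps the notion symmetric in \<open>U\<close> and
  \<open>V\<close>. The order equivalence, required of all pairs, makes the relation single-valued
  and injective.\<close>

definition partial_iso :: "'a::linorder set \<Rightarrow> 'b::linorder set \<Rightarrow> ('a \<times> 'b) set \<Rightarrow> bool" where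
  "partial_iso U V p \<longleftrightarrow> finite p \<and> p \<subseteq> U \<times> V \<and>
     (\<forall>(a, b)\<in>p. \<forall>(a', b')\<in>p. a < a' \<longleftrightarrow> b < b')"

lemma countable_dense_unbounded_separation:
  fixes U :: "'a::linorder set"
  assumes U: "countable_dense_unbounded U" and fin: "finite L" "finite R" and sub: "L \<subseteq> U" "R \<subseteq> U"
    and less: "\<And>l r. l \<in> L \<Longrightarrow> r \<in> R \<Longrightarrow> l < r"
  shows "\<exists>x\<in>U. (\<forall>l\<in>L. l < x) \<and> (\<forall>r\<in>R. x < r)"
proof (cases "L = {}")
  case True
  show ?thesis
  proof (cases "R = {}")
    case True
    with \<open>L = {}\<close> U show ?thesis by (auto simp: countable_dense_unbounded_def)
  next
    case False
    then have "Min R \<in> R" "Min R \<in> U" using fin sub Min_in[of R] by blast+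
    then obtain y where "y \<in> U" "y < Min R" using U unfolding countable_dense_unbounded_def by blast
    then show ?thesis using \<open>L = {}\<close> False fin by auto
  qed
next
  case False
  then have L: "Max L \<in> L" "Max L \<in> U" using fin sub Max_in[of L] by blast+
  show ?thesis
  proof (cases "R = {}")
    case True
    obtain y where "y \<in> U" "Max L < y" using U L unfolding countable_dense_unbounded_def by blast
    then show ?thesis using \<open>R = {}\<close> False fin by auto
  next
    case ne: False
    then have R: "Min R \<in> R" "Min R \<in> U" using fin sub Min_in[of R] by blast+
    have "Max L < Min R" using less L R by auto
    then obtain y where "y \<in> U" "Max L < y" "y < Min R"
      using U L R unfolding countable_dense_unbounded_def by meson
    then show ?thesis using ne False fin by auto
  qed
qed

text \<open>The partner of a new point \<open>a\<close> has to lie above the partners of points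
  below \<open>a\<close> and below the partners of points above \<open>a\<close>. Since
  \<open>p\<close> respects the order, these two finite sets are separated, and density or
  unboundedness of \<open>V\<close> leaves room between them.\<close>

lemma partial_iso_extend:
  assumes V: "countable_dense_unbounded V" and p: "partial_iso U V p" and a: "a \<in> U"
  shows "\<exists>b. partial_iso U V (insert (a, b) p)"
proof (cases "a \<in> Domain p")
  case True
  then obtain b where "(a, b) \<in> p" by auto
  then have "insert (a, b) p = p" by auto
  with p show ?thesis by metis
next
  case False
  have fin: "finite p" and sub: "p \<subseteq> U \<times> V"
    and ord: "\<And>x y x' y'. (x, y) \<in> p \<Longrightarrow> (x', y') \<in> p \<Longrightarrow> x < x' \<longleftrightarrow> y < y'"
    using p unfolding partial_iso_def by blast+
  define L where "L = snd ` {z\<in>p. fst z < a}"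
  define R where "R = snd ` {z\<in>p. a < fst z}"
  have "\<exists>b\<in>V. (\<forall>l\<in>L. l < b) \<and> (\<forall>r\<in>R. b < r)"
  proof (rule countable_dense_unbounded_separation[OF V])
    fix l r assume "l \<in> L" "r \<in> R"
    then obtain x y where "(x, l) \<in> p" "x < a" "(y, r) \<in> p" "a < y"
      by (auto simp: L_def R_def)
    then show "l < r" using ord by (meson less_trans)
  qed (use fin sub in \<open>auto simp: L_def R_def\<close>)
  then obtain b where b: "b \<in> V" "\<And>l. l \<in> L \<Longrightarrow> l < b" "\<And>r. r \<in> R \<Longrightarrow> b < r" by blast
  have new: "(x < a \<longleftrightarrow> y < b) \<and> (a < x \<longleftrightarrow> b < y)" if "(x, y) \<in> p" for x y
  proof -
    have "x < a \<or> a < x" using False that by (metis Domain.DomainI neqE)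
    then show ?thesis
    proof
      assume "x < a"
      moreover from this that have "y \<in> L" by (force simp: L_def)
      ultimately show ?thesis using b by (meson less_asym)
    next
      assume "a < x"
      moreover from this that have "y \<in> R" by (force simp: R_def)
      ultimately show ?thesis using b by (meson less_asym)
    qed
  qed
  have "partial_iso U V (insert (a, b) p)"
    unfolding partial_iso_def using fin sub a b(1) new ord by auto
  then show ?thesis ..
qed

lemma partial_iso_converse: "partial_iso U V p \<Longrightarrow> partial_iso V U (p\<inverse>)"
  unfolding partial_iso_def by fastforce

text \<open>Back and forth: finite partial isomorphisms grow in stages, and each stage takes in the
  next element of an enumeration of \<open>U\<close> and of an enumeration of
  \<open>V\<close>.\<close>

theorem Cantor_isomorphism:
  fixes U :: "'a::linorder set" and V :: "'b::linorder set"
  assumes U: "countable_dense_unbounded U" and V: "countable_dense_unbounded V"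
  shows "\<exists>f. bij_betw f U V \<and> strict_mono_on U f"
proof -
  have neU: "U \<noteq> {}" "countable U" and neV: "V \<noteq> {}" "countable V"
    using U V by (auto simp: countable_dense_unbounded_def)
  have step: "\<exists>q. partial_iso U V q \<and> p \<subseteq> q \<and> from_nat_into U n \<in> Domain q \<and> from_nat_into V n \<in> Range q"
    if p: "partial_iso U V p" for p n
  proof -
    obtain b where b: "partial_iso U V (insert (from_nat_into U n, b) p)"
      using partial_iso_extend[OF V p from_nat_into[OF neU(1)]] by blast
    \<comment> \<open>The back step is the forth step applied to the converse relation.\<close>
    obtain a where "partial_iso V U (insert (from_nat_into V n, a) ((insert (from_nat_into U n, b) p)\<inverse>))"
      using partial_iso_extend[OF U partial_iso_converse[OF b] from_nat_into[OF neV(1)]] by blast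
    from partial_iso_converse[OF this] show ?thesis
      by (intro exI conjI, assumption) auto
  qed
  have "\<exists>P. \<forall>n. partial_iso U V (P n) \<and> (P n \<subseteq> P (Suc n) \<and>
      from_nat_into U n \<in> Domain (P (Suc n)) \<and> from_nat_into V n \<in> Range (P (Suc n)))"
    by (rule dependent_nat_choice) (use step in \<open>auto simp: partial_iso_def\<close>)
  then obtain P where P: "\<And>n. partial_iso U V (P n)" "\<And>n. P n \<subseteq> P (Suc n)"
      "\<And>n. from_nat_into U n \<in> Domain (P (Suc n))" "\<And>n. from_nat_into V n \<in> Range (P (Suc n))"
    by blast
  define R where "R = (\<Union>n. P n)"
  have mono: "P m \<subseteq> P n" if "m \<le> n" for m n
    using lift_Suc_mono_le[of P, OF P(2) that] .
  \<comment> \<open>The stages increase, so any two pairs of \<open>R\<close> lie in a common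
    stage.\<close>
  have ord: "x < x' \<longleftrightarrow> y < y'" if xy: "(x, y) \<in> R" "(x', y') \<in> R" for x y x' y'
  proof -
    obtain m n where "(x, y) \<in> P m" "(x', y') \<in> P n" using xy by (auto simp: R_def)
    then have "(x, y) \<in> P (max m n)" "(x', y') \<in> P (max m n)"
      using mono[of m "max m n"] mono[of n "max m n"] by auto
    then show ?thesis using P(1)[of "max m n"] unfolding partial_iso_def by blast
  qed
  have RUV: "R \<subseteq> U \<times> V" using P(1) by (auto simp: R_def partial_iso_def)
  have dom: "\<exists>y. (x, y) \<in> R" if "x \<in> U" for x
    using P(3)[of "to_nat_on U x"] that neU by (auto simp: R_def)
  have ran: "\<exists>x. (x, y) \<in> R" if "y \<in> V" for y
    using P(4)[of "to_nat_on V y"] that neV by (auto simp: R_def)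
  obtain f where f: "\<And>x. x \<in> U \<Longrightarrow> (x, f x) \<in> R" using dom by metis
  have fun1: "y = y'" if "(x, y) \<in> R" "(x, y') \<in> R" for x y y'
    using ord[OF that] ord[OF that(2,1)] by (metis less_irrefl linorder_neqE)
  have sm: "strict_mono_on U f" unfolding strict_mono_on_def using ord[OF f f] by blast
  moreover have "f ` U = V"
  proof
    show "f ` U \<subseteq> V" using f RUV by auto
    show "V \<subseteq> f ` U"
    proof
      fix y assume "y \<in> V"
      then obtain x where x: "(x, y) \<in> R" using ran by blast
      then have "x \<in> U" using RUV by blast
      then show "y \<in> f ` U" using fun1[OF x f] by blast
    qed
  qed
  moreover have "inj_on f U" using sm by (rule strict_mono_on_imp_inj_on)
  ultimately show ?thesis by (auto simp: bij_betw_def)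
qed

subsection \<open>Homeomorphisms between open sets of rationals\<close>

abbreviation qopen :: "rat set \<Rightarrow> bool" where
  "qopen \<equiv> openin rat_topology"

abbreviation qclopen :: "rat set \<Rightarrow> bool" where
  "qclopen A \<equiv> qopen A \<and> qopen (- A)"

text \<open>Below every positive real radius there is a positive rational one, so openness can be
  tested inside the rationals and the reals drop out of most later arguments.\<close>

lemma qopen_iff: "qopen S \<longleftrightarrow> (\<forall>x\<in>S. \<exists>e>0. \<forall>y. \<bar>y - x\<bar> < e \<longrightarrow> y \<in> S)"
proof
  assume "qopen S"
  then obtain W where W: "open W" "S = (of_rat :: rat \<Rightarrow> real) -` W"
    by (auto simp: rat_topology_def openin_pullback_topology)
  show "\<forall>x\<in>S. \<exists>e>0. \<forall>y. \<bar>y - x\<bar> < e \<longrightarrow> y \<in> S"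
  proof
    fix x assume "x \<in> S"
    then obtain d where d: "d > 0" "\<And>z. dist z (of_rat x) < d \<Longrightarrow> z \<in> W"
      using W by (auto simp: open_dist)
    obtain e where e: "0 < (of_rat e :: real)" "of_rat e < d" using of_rat_dense[OF d(1)] by blast
    have "y \<in> S" if "\<bar>y - x\<bar> < e" for y
    proof -
      have "dist (of_rat y :: real) (of_rat x) = of_rat \<bar>y - x\<bar>"
        by (simp add: dist_real_def of_rat_diff abs_if of_rat_less)
      also have "\<dots> < d" using that e by (meson less_trans of_rat_less)
      finally show ?thesis using d W by auto
    qed
    then show "\<exists>e>0. \<forall>y. \<bar>y - x\<bar> < e \<longrightarrow> y \<in> S" using e by auto
  qed
next
  assume S: "\<forall>x\<in>S. \<exists>e>0. \<forall>y. \<bar>y - x\<bar> < e \<longrightarrow> y \<in> S"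
  then obtain e where e: "\<And>x. x \<in> S \<Longrightarrow> e x > 0" "\<And>x y. x \<in> S \<Longrightarrow> \<bar>y - x\<bar> < e x \<Longrightarrow> y \<in> S"
    by metis
  define W where "W = (\<Union>x\<in>S. ball (of_rat x :: real) (of_rat (e x)))"
  have "S = of_rat -` W"
  proof
    show "S \<subseteq> of_rat -` W" using e(1) by (force simp: W_def)
    show "of_rat -` W \<subseteq> S"
    proof
      fix y assume "y \<in> (of_rat :: rat \<Rightarrow> real) -` W"
      then obtain x where x: "x \<in> S" "dist (of_rat x :: real) (of_rat y) < of_rat (e x)"
        by (auto simp: W_def)
      have "dist (of_rat x :: real) (of_rat y) = of_rat \<bar>y - x\<bar>"
        by (auto simp: dist_real_def of_rat_diff abs_if of_rat_less)
      then show "y \<in> S" using x e by (simp add: of_rat_less)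
    qed
  qed
  moreover have "open W" by (auto simp: W_def)
  ultimately show "qopen S" by (auto simp: rat_topology_def openin_pullback_topology)
qed

lemma qopen_countable_dense_unbounded:
  assumes "qopen U" "U \<noteq> {}"
  shows "countable_dense_unbounded U"
proof -
  have near: "\<exists>e>0. \<forall>y. \<bar>y - x\<bar> < e \<longrightarrow> y \<in> U" if "x \<in> U" for x
    using assms that by (auto simp: qopen_iff)
  show ?thesis unfolding countable_dense_unbounded_def
  proof (intro conjI ballI impI)
    fix x assume "x \<in> U"
    then obtain e where e: "e > 0" "\<And>y. \<bar>y - x\<bar> < e \<Longrightarrow> y \<in> U" using near by blast
    show "\<exists>y\<in>U. y < x" using e by (intro bexI[of _ "x - e/2"]) auto
    show "\<exists>y\<in>U. x < y" using e by (intro bexI[of _ "x + e/2"]) auto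
    fix y assume "y \<in> U" "x < y"
    \<comment> \<open>The midpoint of \<open>x\<close> and \<open>y\<close> may lie outside
      \<open>U\<close>, so the point is also taken close to \<open>x\<close>.\<close>
    then show "\<exists>z\<in>U. x < z \<and> z < y"
      using e by (intro bexI[of _ "x + min (e/2) ((y - x)/2)"]) (auto simp: min_def field_simps)
  qed (use assms in auto)
qed

text \<open>On an open set the subspace topology is the order topology of the induced order. Hence
  an order isomorphism between open sets preserves and reflects openness.\<close>

lemma qopen_subset_iff:
  assumes U: "qopen U" and S: "S \<subseteq> U"
  shows "qopen S \<longleftrightarrow> (\<forall>x\<in>S. \<exists>l\<in>U. \<exists>r\<in>U. l < x \<and> x < r \<and> (\<forall>y\<in>U. l < y \<and> y < r \<longrightarrow> y \<in> S))"
proof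
  assume S': "qopen S"
  show "\<forall>x\<in>S. \<exists>l\<in>U. \<exists>r\<in>U. l < x \<and> x < r \<and> (\<forall>y\<in>U. l < y \<and> y < r \<longrightarrow> y \<in> S)"
  proof
    fix x assume "x \<in> S"
    then obtain e where e: "e > 0" "\<And>y. \<bar>y - x\<bar> < e \<Longrightarrow> y \<in> S" using S' by (auto simp: qopen_iff)
    have "x - e/2 \<in> U" "x + e/2 \<in> U" using e S by auto
    moreover have "y \<in> S" if "x - e/2 < y" "y < x + e/2" for y
      using that e(1) by (intro e(2)) (auto simp: abs_less_iff field_simps)
    ultimately show "\<exists>l\<in>U. \<exists>r\<in>U. l < x \<and> x < r \<and> (\<forall>y\<in>U. l < y \<and> y < r \<longrightarrow> y \<in> S)"
      using e(1) by (intro bexI[of _ "x - e/2"] bexI[of _ "x + e/2"]) auto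
  qed
next
  assume *: "\<forall>x\<in>S. \<exists>l\<in>U. \<exists>r\<in>U. l < x \<and> x < r \<and> (\<forall>y\<in>U. l < y \<and> y < r \<longrightarrow> y \<in> S)"
  show "qopen S" unfolding qopen_iff
  proof
    fix x assume x: "x \<in> S"
    then obtain l r where lr: "l < x" "x < r" "\<And>y. y \<in> U \<Longrightarrow> l < y \<Longrightarrow> y < r \<Longrightarrow> y \<in> S"
      using * by meson
    obtain e where e: "e > 0" "\<And>y. \<bar>y - x\<bar> < e \<Longrightarrow> y \<in> U"
      using U S x unfolding qopen_iff by blast
    show "\<exists>e>0. \<forall>y. \<bar>y - x\<bar> < e \<longrightarrow> y \<in> S"
      using lr e by (intro exI[of _ "min e (min (x - l) (r - x))"]) (auto simp: abs_less_iff)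
  qed
qed

text \<open>For open \<open>U\<close> and \<open>V\<close> the relatively open subsets are the open
  subsets, so this says that \<open>f\<close> restricts to a homeomorphism of \<open>U\<close> onto
  \<open>V\<close>. Values outside \<open>U\<close> are arbitrary, which lets maps be glued by a
  case distinction.\<close>

definition homeo_between :: "rat set \<Rightarrow> rat set \<Rightarrow> (rat \<Rightarrow> rat) \<Rightarrow> bool" where
  "homeo_between U V f \<longleftrightarrow> bij_betw f U V \<and> (\<forall>S\<subseteq>U. qopen (f ` S) \<longleftrightarrow> qopen S)"

text \<open>The order isomorphism from Cantor's theorem works, because
  \<open>qopen_subset_iff\<close> describes openness on both sides by the order alone.\<close>

lemma homeo_between_exists:
  assumes U: "qopen U" "U \<noteq> {}" and V: "qopen V" "V \<noteq> {}"
  shows "\<exists>f. homeo_between U V f"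
proof -
  obtain f where f: "bij_betw f U V" "strict_mono_on U f"
    using Cantor_isomorphism qopen_countable_dense_unbounded assms by blast
  have less: "f x < f y \<longleftrightarrow> x < y" if "x \<in> U" "y \<in> U" for x y
    using f(2) that by (rule strict_mono_on_less)
  have fU: "f ` U = V" and inj: "inj_on f U" using f(1) by (auto simp: bij_betw_def)
  have "qopen (f ` S) \<longleftrightarrow> qopen S" if S: "S \<subseteq> U" for S
  proof -
    have "f ` S \<subseteq> V" using S fU by blast
    from qopen_subset_iff[OF V(1) this]
    have "qopen (f ` S) \<longleftrightarrow> (\<forall>x\<in>S. \<exists>l\<in>U. \<exists>r\<in>U. f l < f x \<and> f x < f r \<and>
        (\<forall>y\<in>U. f l < f y \<and> f y < f r \<longrightarrow> f y \<in> f ` S))"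
      unfolding fU[symmetric] by simp
    also have "\<dots> \<longleftrightarrow> (\<forall>x\<in>S. \<exists>l\<in>U. \<exists>r\<in>U. l < x \<and> x < r \<and> (\<forall>y\<in>U. l < y \<and> y < r \<longrightarrow> y \<in> S))"
      using S by (intro ball_cong bex_cong refl) (simp add: less subset_iff inj_on_image_mem_iff[OF inj _ S])
    also have "\<dots> \<longleftrightarrow> qopen S" using qopen_subset_iff[OF U(1) S] ..
    finally show ?thesis .
  qed
  with f show ?thesis by (auto simp: homeo_between_def)
qed

text \<open>A subset of a union of two open sets is open exactly when both of its traces are; this
  is applied in the source and in the target.\<close>

lemma homeo_between_glue:
  assumes f: "homeo_between U V f" and g: "homeo_between U' V' g"
    and opn: "qopen U" "qopen U'" "qopen V" "qopen V'"
    and disj: "U \<inter> U' = {}" "V \<inter> V' = {}"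
  shows "homeo_between (U \<union> U') (V \<union> V') (\<lambda>x. if x \<in> U then f x else g x)"
    (is "homeo_between _ _ ?h")
proof -
  have "bij_betw ?h U V" using f by (auto simp: homeo_between_def cong: bij_betw_cong)
  moreover have "bij_betw ?h U' V'"
    using g disj by (subst bij_betw_cong[of _ _ g]) (auto simp: homeo_between_def)
  ultimately have bij: "bij_betw ?h (U \<union> U') (V \<union> V')"
    using disj(2) by (rule bij_betw_combine)
  have "qopen (?h ` S) \<longleftrightarrow> qopen S" if S: "S \<subseteq> U \<union> U'" for S
  proof -
    have S_eq: "S = (S \<inter> U) \<union> (S \<inter> U')" using S by auto
    have h_eq: "?h ` S = f ` (S \<inter> U) \<union> g ` (S \<inter> U')" using S disj(1) by (auto simp: image_iff)
    have fV: "f ` (S \<inter> U) \<subseteq> V" "g ` (S \<inter> U') \<subseteq> V'"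
      using f g by (auto simp: homeo_between_def bij_betw_def)
    have 1: "qopen (f ` (S \<inter> U)) \<longleftrightarrow> qopen (S \<inter> U)" "qopen (g ` (S \<inter> U')) \<longleftrightarrow> qopen (S \<inter> U')"
      using f g by (auto simp: homeo_between_def)
    have "qopen S \<longleftrightarrow> qopen (S \<inter> U) \<and> qopen (S \<inter> U')"
      using S_eq opn by (metis openin_Int openin_Un)
    moreover have "qopen (?h ` S) \<longleftrightarrow> qopen (f ` (S \<inter> U)) \<and> qopen (g ` (S \<inter> U'))"
    proof
      have "?h ` S \<inter> V = f ` (S \<inter> U)" "?h ` S \<inter> V' = g ` (S \<inter> U')"
        using h_eq fV disj(2) by auto
      then show "qopen (?h ` S) \<Longrightarrow> qopen (f ` (S \<inter> U)) \<and> qopen (g ` (S \<inter> U'))"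
        using opn by (metis openin_Int)
      show "qopen (f ` (S \<inter> U)) \<and> qopen (g ` (S \<inter> U')) \<Longrightarrow> qopen (?h ` S)"
        unfolding h_eq by auto
    qed
    ultimately show ?thesis using 1 by simp
  qed
  with bij show ?thesis by (auto simp: homeo_between_def)
qed

lemma homeo_between_id: "homeo_between U U (\<lambda>x. x)"
  by (auto simp: homeo_between_def bij_betw_def)

text \<open>The quotient map condition inside \<open>homeomorphic_map\<close> speaks of preimages;
  for a bijection it can be rephrased with images.\<close>

lemma homeomorphic_map_rat_iff:
  "homeomorphic_map rat_topology rat_topology f \<longleftrightarrow> homeo_between UNIV UNIV f"
proof -
  have "(\<forall>U. qopen {x. f x \<in> U} = qopen U) \<longleftrightarrow> (\<forall>S. qopen (f ` S) \<longleftrightarrow> qopen S)" if "bij f"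
  proof -
    have "f ` {x. f x \<in> U} = U" for U using that by (metis bij_is_surj surj_image_vimage_eq vimage_def)
    moreover have "{x. f x \<in> f ` S} = S" for S using that by (auto simp: bij_def inj_def)
    ultimately show ?thesis by metis
  qed
  then show ?thesis
    by (auto simp: homeomorphic_map_def quotient_map_def homeo_between_def bij_def bij_betw_def)
qed

subsection \<open>The group of homeomorphisms of the rationals\<close>

lemma Homeo_Q_iff: "f \<in> carrier Homeo_Q \<longleftrightarrow> bij f \<and> (\<forall>S. qopen (f ` S) \<longleftrightarrow> qopen S)"
  by (simp add: carrier_Homeo_Q homeomorphic_map_rat_iff homeo_between_def)

lemma homeo_between_UNIV: "homeo_between UNIV UNIV f \<longleftrightarrow> f \<in> carrier Homeo_Q"
  by (simp add: carrier_Homeo_Q homeomorphic_map_rat_iff)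

lemma inv_Homeo_Q:
  assumes "f \<in> carrier Homeo_Q" shows "inv\<^bsub>Homeo_Q\<^esub> f = Hilbert_Choice.inv f"
proof -
  have "bij f" using assms by (simp add: Homeo_Q_iff)
  \<comment> \<open>Maps act on the right, so the left inverse law reads "first the inverse, then
    \<open>f\<close>".\<close>
  moreover have "(f \<circ> inv\<^bsub>Homeo_Q\<^esub> f) = id"
    using group.l_inv[OF group_Homeo_group assms] by (simp add: mult_Homeo_Q one_Homeo_Q)
  ultimately show ?thesis by (metis bij_betw_def inv_o_cancel comp_assoc comp_id id_comp)
qed

lemma subgroup_Homeo_Q_iff:
  "subgroup H Homeo_Q \<longleftrightarrow> H \<subseteq> carrier Homeo_Q \<and> id \<in> H \<and>
     (\<forall>f\<in>H. \<forall>g\<in>H. g \<circ> f \<in> H) \<and> (\<forall>f\<in>H. Hilbert_Choice.inv f \<in> H)"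
proof -
  have "(\<forall>f\<in>H. inv\<^bsub>Homeo_Q\<^esub> f \<in> H) \<longleftrightarrow> (\<forall>f\<in>H. Hilbert_Choice.inv f \<in> H)" if "H \<subseteq> carrier Homeo_Q"
    using that inv_Homeo_Q by (metis subsetD)
  then show ?thesis unfolding subgroup_def mult_Homeo_Q one_Homeo_Q by blast
qed

lemma subgroup_Homeo_QD:
  assumes "subgroup H Homeo_Q"
  shows "H \<subseteq> carrier Homeo_Q" "id \<in> H" "f \<in> H \<Longrightarrow> g \<in> H \<Longrightarrow> g \<circ> f \<in> H"
    "f \<in> H \<Longrightarrow> Hilbert_Choice.inv f \<in> H"
  using assms by (auto simp: subgroup_Homeo_Q_iff)

lemmas Homeo_Q_comp = subgroup_Homeo_QD(3)[OF group.subgroup_self[OF group_Homeo_group]]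
lemmas Homeo_Q_inv = subgroup_Homeo_QD(4)[OF group.subgroup_self[OF group_Homeo_group]]
lemmas Homeo_Q_id = subgroup_Homeo_QD(2)[OF group.subgroup_self[OF group_Homeo_group]]

text \<open>Membership in \<open>H\<close> may be tested after composing with an element of
  \<open>H\<close>; this is how a given map is simplified step by step.\<close>

lemma subgroup_comp_cancel:
  assumes H: "subgroup H Homeo_Q" and g: "g \<in> H" "bij g" and "g \<circ> f \<in> H"
  shows "f \<in> H"
proof -
  have "f = Hilbert_Choice.inv g \<circ> (g \<circ> f)"
    using g by (simp add: bij_is_inj comp_assoc[symmetric])
  then show ?thesis using subgroup_Homeo_QD(3,4)[OF H] assms by metis
qed

lemma qclopen_image: "f \<in> carrier Homeo_Q \<Longrightarrow> qclopen (f ` A) \<longleftrightarrow> qclopen A"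
  by (metis Homeo_Q_iff bij_image_Compl_eq)

lemma qclopen_Int: "qclopen A \<Longrightarrow> qclopen B \<Longrightarrow> qclopen (A \<inter> B)"
  and qclopen_Un: "qclopen A \<Longrightarrow> qclopen B \<Longrightarrow> qclopen (A \<union> B)"
  and qclopen_Diff: "qclopen A \<Longrightarrow> qclopen B \<Longrightarrow> qclopen (A - B)"
  by (auto simp: Diff_eq)

section \<open>Homeomorphisms supported in a clopen set\<close>

definition supported :: "rat set \<Rightarrow> (rat \<Rightarrow> rat) set" where
  "supported A = {f \<in> carrier Homeo_Q. \<forall>x. x \<notin> A \<longrightarrow> f x = x}"

lemma supported_image:
  assumes "f \<in> supported A" "A \<subseteq> B"
  shows "f ` B = B"
proof -
  have "bij f" and fix_out: "\<And>x. x \<notin> A \<Longrightarrow> f x = x" using assms by (auto simp: supported_def Homeo_Q_iff)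
  then have "f ` (- B) = - B" using assms(2) by (force simp: image_iff)
  then show ?thesis using \<open>bij f\<close> by (metis bij_image_Compl_eq double_complement)
qed

lemma supported_comp: "f \<in> supported A \<Longrightarrow> g \<in> supported A \<Longrightarrow> g \<circ> f \<in> supported A"
  by (auto simp: supported_def intro: Homeo_Q_comp)

lemma supported_mono: "A \<subseteq> B \<Longrightarrow> supported A \<subseteq> supported B"
  by (auto simp: supported_def)

lemma supported_UNIV: "supported UNIV = carrier Homeo_Q"
  by (auto simp: supported_def)

lemma homeo_glue2:
  assumes "homeo_between A A' f" "homeo_between (- A) (- A') g" "qclopen A" "qclopen A'"
  shows "(\<lambda>x. if x \<in> A then f x else g x) \<in> carrier Homeo_Q"
  using homeo_between_glue[OF assms(1,2)] assms(3,4) by (simp add: homeo_between_UNIV)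

text \<open>Both \<open>P\<close>, \<open>Q\<close> and the remainders \<open>A - P\<close>,
  \<open>A - Q\<close> are nonempty and open, so each pair is homeomorphic. The two maps are glued
  and extended by the identity outside \<open>A\<close>.\<close>

lemma supported_move:
  assumes A: "qclopen A" and P: "qclopen P" "P \<subseteq> A" "P \<noteq> {}" "P \<noteq> A"
    and Q: "qclopen Q" "Q \<subseteq> A" "Q \<noteq> {}" "Q \<noteq> A"
  obtains f where "f \<in> supported A" "f ` P = Q"
proof -
  obtain f where f: "homeo_between P Q f" using homeo_between_exists P Q by blast
  have "\<exists>g. homeo_between (A - P) (A - Q) g"
    using P Q A qclopen_Diff by (intro homeo_between_exists) auto
  then obtain g where g: "homeo_between (A - P) (A - Q) g" ..
  define h where "h x = (if x \<in> P then f x else g x)" for x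
  have eq: "P \<union> (A - P) = A" "Q \<union> (A - Q) = A" using P Q by auto
  have h: "homeo_between A A h"
    unfolding h_def using homeo_between_glue[OF f g] P Q A qclopen_Diff unfolding eq by blast
  have "(\<lambda>x. if x \<in> A then h x else x) \<in> supported A"
    using homeo_glue2[OF h homeo_between_id A A] by (simp add: supported_def)
  moreover have "(\<lambda>x. if x \<in> A then h x else x) ` P = Q"
    using f P(2) by (auto simp: h_def homeo_between_def bij_betw_def image_iff subset_iff)
  ultimately show ?thesis using that by blast
qed

lemma supported_restrict:
  assumes f: "f \<in> carrier Homeo_Q" and D: "qclopen D" "f ` D = D"
  shows "(\<lambda>x. if x \<in> D then f x else x) \<in> supported D"
proof -
  have "homeo_between D D f"
    using f D(2) by (auto simp: homeo_between_def Homeo_Q_iff bij_betw_def bij_def intro: inj_on_subset)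
  from homeo_glue2[OF this homeo_between_id D(1) D(1)] show ?thesis by (simp add: supported_def)
qed

text \<open>The third piece on either side is the complement of the union. It is nonempty on both
  sides, so all three pairs of pieces are homeomorphic.\<close>

lemma homeo_three_pieces:
  assumes P: "qclopen P1" "qclopen P2" "P1 \<inter> P2 = {}" "P1 \<noteq> {}" "P2 \<noteq> {}" "P1 \<union> P2 \<noteq> UNIV"
    and Q: "qclopen Q1" "qclopen Q2" "Q1 \<inter> Q2 = {}" "Q1 \<noteq> {}" "Q2 \<noteq> {}" "Q1 \<union> Q2 \<noteq> UNIV"
  obtains f where "f \<in> carrier Homeo_Q" "f ` P1 = Q1" "f ` P2 = Q2"
proof -
  obtain f1 f2 where f: "homeo_between P1 Q1 f1" "homeo_between P2 Q2 f2"
    using homeo_between_exists P Q by meson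
  have "\<exists>g. homeo_between (- (P1 \<union> P2)) (- (Q1 \<union> Q2)) g"
    using P Q by (intro homeo_between_exists) (auto simp: Compl_Un)
  then obtain g where g: "homeo_between (- (P1 \<union> P2)) (- (Q1 \<union> Q2)) g" ..
  define h where "h x = (if x \<in> P1 then f1 x else f2 x)" for x
  have h: "homeo_between (P1 \<union> P2) (Q1 \<union> Q2) h"
    unfolding h_def using homeo_between_glue[OF f] P Q by blast
  let ?k = "\<lambda>x. if x \<in> P1 \<union> P2 then h x else g x"
  have "?k \<in> carrier Homeo_Q"
    using homeo_glue2[OF h g] P Q qclopen_Un by metis
  moreover have "?k ` P1 = Q1"
    using f(1) by (auto simp: h_def homeo_between_def bij_betw_def image_iff)
  moreover have "?k ` P2 = f2 ` P2"
    using P(3) by (intro image_cong) (auto simp: h_def)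
  then have "?k ` P2 = Q2" using f(2) by (auto simp: homeo_between_def bij_betw_def)
  ultimately show ?thesis using that by blast
qed

section \<open>Clopen sets from irrational cuts\<close>

lemma qclopen_lessThan:
  fixes r :: real
  assumes "r \<notin> \<rat>"
  shows "qclopen {q. of_rat q < r}"
proof -
  \<comment> \<open>No rational equals \<open>r\<close>, so the complement of the lower ray is again
    an open ray.\<close>
  have "- {q. of_rat q < r} = of_rat -` {r<..}"
    using assms by (auto simp: not_less) (metis Rats_of_rat less_eq_real_def)
  moreover have "{q. of_rat q < r} = of_rat -` {..<r}" by auto
  moreover have "qopen (of_rat -` W)" if "open W" for W :: "real set"
    using that by (auto simp: rat_topology_def openin_pullback_topology)
  ultimately show ?thesis by simp
qed

lemma irrational_between:
  fixes a b :: real assumes "a < b"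
  obtains r where "r \<notin> \<rat>" "a < r" "r < b"
proof -
  have "\<not> {a<..<b} \<subseteq> \<rat>"
    using countable_subset[of "{a<..<b}" \<rat>] countable_rat uncountable_open_interval[of a b] assms by blast
  then obtain r where "r \<in> {a<..<b}" "r \<notin> \<rat>" by blast
  then show ?thesis using that by auto
qed

lemma qclopen_split:
  assumes "qopen A" "A \<noteq> {}"
  obtains P where "qclopen P" "P \<inter> A \<noteq> {}" "\<not> A \<subseteq> P"
proof -
  obtain x y where xy: "x \<in> A" "y \<in> A" "x < y"
    using qopen_countable_dense_unbounded[OF assms] unfolding countable_dense_unbounded_def by blast
  obtain r :: real where r: "r \<notin> \<rat>" "of_rat x < r" "r < of_rat y"
    using irrational_between[of "of_rat x" "of_rat y"] xy by (auto simp: of_rat_less)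
  show ?thesis
  proof (rule that[OF qclopen_lessThan[OF r(1)]])
    show "{q. of_rat q < r} \<inter> A \<noteq> {}" using xy r by blast
    show "\<not> A \<subseteq> {q. of_rat q < r}" using xy(2) r(3) by auto
  qed
qed

lemma qclopen_proper_subset:
  assumes "qclopen A" "A \<noteq> {}"
  obtains P where "qclopen P" "P \<subseteq> A" "P \<noteq> {}" "P \<noteq> A"
proof -
  obtain P where "qclopen P" "P \<inter> A \<noteq> {}" "\<not> A \<subseteq> P" using qclopen_split assms by blast
  then show ?thesis using that[of "P \<inter> A"] qclopen_Int assms by auto
qed

text \<open>Given \<open>f\<close> supported in \<open>A \<union> B\<close>, elements supported in \<open>A\<close> or \<open>B\<close> move
  \<open>f ` (B - A)\<close> back to \<open>B - A\<close>; what remains splits into a part supported in \<open>B - A\<close> and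
  a part supported in \<open>A\<close>.\<close>

lemma supported_generate:
  assumes A: "qclopen A" and B: "qclopen B" and AB: "A \<inter> B \<noteq> {}"
    and H: "subgroup H Homeo_Q" "supported A \<subseteq> H" "supported B \<subseteq> H"
  shows "supported (A \<union> B) \<subseteq> H"
proof (cases "B \<subseteq> A")
  case True
  then show ?thesis using H(2) by (simp add: Un_absorb2)
next
  case False
  define X where "X = A \<union> B"
  define D where "D = B - A"
  have D: "qclopen D" "D \<subseteq> B" "D \<noteq> {}" "D \<noteq> B" "X - D = A" "D \<subseteq> X"
    using False AB qclopen_Diff[OF B A] by (auto simp: D_def X_def)
  have bijs: "bij f" if "f \<in> supported C" for f C using that by (simp add: supported_def Homeo_Q_iff)
  have car: "f \<in> carrier Homeo_Q" if "f \<in> supported C" for f C using that by (simp add: supported_def)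
  have AX: "supported A \<subseteq> supported X" and BX: "supported B \<subseteq> supported X"
    by (auto simp: X_def supported_def)
  have clo: "qclopen (f ` D)" if "f \<in> supported X" for f
    using qclopen_image[OF car[OF that]] D(1) by blast
  \<comment> \<open>First case: the image of \<open>D\<close> is a proper part of \<open>B\<close>,
    so a single map supported in \<open>B\<close> returns it to \<open>D\<close>.\<close>
  have step1: "f \<in> H" if f: "f \<in> supported X" and fD: "f ` D \<subseteq> B" "f ` D \<noteq> B" for f
  proof -
    obtain b where b: "b \<in> supported B" "b ` (f ` D) = D"
      using supported_move[OF B clo[OF f] fD(1) _ fD(2) D(1,2,3,4)] D(3) by blast
    define g where "g = b \<circ> f"
    have g: "g \<in> supported X" "g ` D = D"
      using b f BX supported_comp by (auto simp: g_def image_comp)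
    define k where "k = (\<lambda>x. if x \<in> D then g x else x)"
    have "k \<in> supported D" unfolding k_def by (rule supported_restrict[OF car[OF g(1)] D(1) g(2)])
    then have k: "k \<in> supported B" "bij k" using supported_mono[OF D(2)] bijs by auto
    have "bij g" using bijs g by blast
    \<comment> \<open>\<open>k\<close> agrees with \<open>g\<close> on \<open>D\<close>, and both
      are the identity outside \<open>X\<close>; what is left of \<open>g\<close> after undoing
      \<open>k\<close> therefore moves only points of \<open>A\<close>.\<close>
    have "Hilbert_Choice.inv k (g x) = x" if "x \<notin> A" for x
    proof (cases "x \<in> D")
      case True
      then have "g x = k x" by (simp add: k_def)
      then show ?thesis using k(2) by (simp add: bij_is_inj)
    next
      case False
      then have "x \<notin> X" using D(5) that by blast
      then have "g x = k x" using g(1) False by (simp add: supported_def k_def)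
      then show ?thesis using k(2) by (simp add: bij_is_inj)
    qed
    then have "Hilbert_Choice.inv k \<circ> g \<in> supported A"
      using car[OF k(1)] car[OF g(1)] by (auto simp: supported_def intro: Homeo_Q_comp Homeo_Q_inv)
    moreover have "Hilbert_Choice.inv k \<in> H" using k H subgroup_Homeo_QD(4) by blast
    moreover have "bij (Hilbert_Choice.inv k)" using k(2) by (rule bij_imp_bij_inv)
    ultimately have "g \<in> H" using subgroup_comp_cancel[OF H(1)] H(2) by blast
    then show "f \<in> H" unfolding g_def using subgroup_comp_cancel[OF H(1)] b(1) H(3) bijs by blast
  qed
  \<comment> \<open>Second case: a map supported in \<open>A\<close> squeezes the part of the image
    of \<open>D\<close> inside \<open>A\<close> into a proper part \<open>Q\<close> of
    \<open>A \<inter> B\<close>. The new image is a proper subset of \<open>B\<close>, as in the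
    first case.\<close>
  have step2: "f \<in> H" if f: "f \<in> supported X" and fD: "\<not> A \<subseteq> f ` D" for f
  proof (cases "f ` D \<inter> A = {}")
    case True
    moreover have "f ` D \<subseteq> X" using supported_image[OF f subset_refl] D(6) by blast
    ultimately show ?thesis using step1[OF f] AB X_def by blast
  next
    case False
    obtain Q where Q: "qclopen Q" "Q \<subseteq> A \<inter> B" "Q \<noteq> {}" "Q \<noteq> A \<inter> B"
      using qclopen_proper_subset[OF qclopen_Int[OF A B] AB] by blast
    obtain a where a: "a \<in> supported A" "a ` (f ` D \<inter> A) = Q"
      using supported_move[OF A qclopen_Int[OF clo[OF f] A] _ False _ Q(1) _ Q(3)] fD Q(2,4) by blast
    have "a ` (f ` D - A) = f ` D - A" using a(1) by (force simp: supported_def image_iff)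
    then have aD: "(a \<circ> f) ` D = Q \<union> (f ` D - A)"
      using a(2) by (metis Int_Diff_Un image_Un image_comp)
    have "f ` D \<subseteq> X" using supported_image[OF f subset_refl] D(6) by blast
    then have "(a \<circ> f) ` D \<subseteq> B" "(a \<circ> f) ` D \<noteq> B" using Q aD by (auto simp: X_def)
    moreover have "a \<circ> f \<in> supported X" using supported_comp f a(1) AX by blast
    ultimately have "a \<circ> f \<in> H" using step1 by blast
    then show "f \<in> H" using subgroup_comp_cancel[OF H(1)] a(1) H(2) bijs by blast
  qed
  \<comment> \<open>Last case: the image of \<open>D\<close> contains \<open>A\<close>. The nonempty
    part of \<open>B\<close> that it misses is carried onto \<open>A \<inter> B\<close> by a map
    supported in \<open>B\<close>; the new image of \<open>D\<close> then misses
    \<open>A \<inter> B\<close>, which leads back to the second case.\<close>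
  have "f \<in> H" if f: "f \<in> supported X" for f
  proof (cases "A \<subseteq> f ` D")
    case True
    have fX: "f ` X = X" using supported_image[OF f subset_refl] .
    have "f ` D \<noteq> X"
    proof
      assume "f ` D = X"
      then have "D = X" using fX bijs[OF f] by (metis bij_is_inj inj_image_eq_iff)
      then show False using AB D_def X_def by blast
    qed
    moreover have "f ` D \<subseteq> X" using fX D(6) by blast
    ultimately have ne: "B - f ` D \<noteq> {}" using True X_def by blast
    obtain b where b: "b \<in> supported B" "b ` (B - f ` D) = A \<inter> B"
    proof (rule supported_move[OF B qclopen_Diff[OF B clo[OF f]] _ ne _ qclopen_Int[OF A B] _ AB])
      show "B - f ` D \<noteq> B" using True AB by blast
      show "A \<inter> B \<noteq> B" using False by blast
    qed auto
    have "(b \<circ> f) ` D \<inter> b ` (B - f ` D) = {}"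
      using bijs[OF b(1)] by (auto simp: bij_def inj_def)
    then have "(b \<circ> f) ` D \<inter> (A \<inter> B) = {}" by (simp add: b(2))
    then have "\<not> A \<subseteq> (b \<circ> f) ` D" using AB by blast
    moreover have "b \<circ> f \<in> supported X" using supported_comp f b(1) BX by blast
    ultimately have "b \<circ> f \<in> H" using step2 by blast
    then show "f \<in> H" using subgroup_comp_cancel[OF H(1)] b(1) H(3) bijs by blast
  qed (use step2[OF f] in blast)
  then show ?thesis by (auto simp: X_def)
qed

subsection \<open>Open sets in admissible group topologies\<close>

lemma group_topology_lmult:
  assumes "group_topology G T" "g \<in> carrier G"
  shows "continuous_map T T (\<lambda>h. g \<otimes>\<^bsub>G\<^esub> h)"
proof -
  have "continuous_map T (prod_topology T T) (\<lambda>h. (g, h))"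
    using assms by (auto simp: group_topology_def continuous_map_paired)
  then have "continuous_map T T ((\<lambda>(x, y). x \<otimes>\<^bsub>G\<^esub> y) \<circ> (\<lambda>h. (g, h)))"
    using assms by (auto simp: group_topology_def intro: continuous_map_compose)
  then show ?thesis by (simp add: o_def)
qed

lemma group_topology_rmult:
  assumes "group_topology G T" "g \<in> carrier G"
  shows "continuous_map T T (\<lambda>h. h \<otimes>\<^bsub>G\<^esub> g)"
proof -
  have "continuous_map T (prod_topology T T) (\<lambda>h. (h, g))"
    using assms by (auto simp: group_topology_def continuous_map_paired)
  then have "continuous_map T T ((\<lambda>(x, y). x \<otimes>\<^bsub>G\<^esub> y) \<circ> (\<lambda>h. (h, g)))"
    using assms by (auto simp: group_topology_def intro: continuous_map_compose)
  then show ?thesis by (simp add: o_def)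
qed

definition admissible :: "(rat \<Rightarrow> rat) topology \<Rightarrow> bool" where
  "admissible T \<longleftrightarrow> group_topology Homeo_Q T \<and>
     continuous_map (prod_topology rat_topology T) rat_topology (\<lambda>(q, h). h q)"

lemma topspace_admissible: "admissible T \<Longrightarrow> topspace T = carrier Homeo_Q"
  by (simp add: admissible_def group_topology_def)

lemma qclopen_inside_qopen:
  assumes "qopen U" "U \<noteq> {}"
  obtains P where "qclopen P" "P \<subseteq> U" "P \<noteq> {}"
proof -
  obtain x where x: "x \<in> U" using assms by blast
  then obtain e where e: "e > 0" "\<And>y. \<bar>y - x\<bar> < e \<Longrightarrow> y \<in> U" using assms unfolding qopen_iff by blast
  obtain r :: real where r: "r \<notin> \<rat>" "of_rat (x - e) < r" "r < of_rat x"
    using irrational_between[of "of_rat (x - e)" "of_rat x"] e(1) by (auto simp: of_rat_less)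
  obtain s :: real where s: "s \<notin> \<rat>" "of_rat x < s" "s < of_rat (x + e)"
    using irrational_between[of "of_rat x" "of_rat (x + e)"] e(1) by (auto simp: of_rat_less)
  let ?P = "{q. of_rat q < s} - {q. of_rat q < r}"
  show ?thesis
  proof (rule that)
    show "qclopen ?P" using qclopen_Diff qclopen_lessThan r(1) s(1) by blast
    show "?P \<noteq> {}" using r s by (auto simp: not_less intro: less_imp_le)
    show "?P \<subseteq> U"
    proof
      fix y assume "y \<in> ?P"
      then have "of_rat (x - e) < (of_rat y :: real)" "(of_rat y :: real) < of_rat (x + e)"
        using r s by auto
      then have "x - e < y" "y < x + e" by (simp_all only: of_rat_less)
      then show "y \<in> U" by (intro e(2)) (auto simp: abs_less_iff)
    qed
  qed
qed

text \<open>Continuity of evaluation at one point gives such a \<open>V\<close> for one pair of clopen sets; every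
  other pair is the image of that one under some \<open>g\<close>, and conjugation by \<open>g\<close> is a homeomorphism of \<open>T\<close>.\<close>

lemma admissible_separate:
  assumes T: "admissible T"
    and BD: "qclopen B" "qclopen D" "B \<inter> D = {}" "B \<noteq> {}" "D \<noteq> {}" "B \<union> D \<noteq> UNIV"
  shows "\<exists>V. openin T V \<and> id \<in> V \<and> (\<forall>h\<in>V. h ` B \<inter> D = {})"
proof -
  have gt: "group_topology Homeo_Q T" using T by (simp add: admissible_def)
  have top: "topspace T = carrier Homeo_Q" by (rule topspace_admissible[OF T])
  obtain W where W: "qclopen W" "W \<noteq> {}" "W \<noteq> UNIV"
    using qclopen_proper_subset[of UNIV] openin_topspace[of rat_topology] by auto
  then obtain x where x: "x \<in> W" by blast
  have "openin (prod_topology rat_topology T)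
      {z \<in> topspace (prod_topology rat_topology T). (case z of (q, h) \<Rightarrow> h q) \<in> W}"
    using T W(1) unfolding admissible_def by (intro openin_continuous_map_preimage) auto
  moreover have "(x, id) \<in> {z \<in> topspace (prod_topology rat_topology T). (case z of (q, h) \<Rightarrow> h q) \<in> W}"
    using x top Homeo_Q_id by simp
  ultimately obtain U V where UV: "qopen U" "openin T V" "x \<in> U" "id \<in> V"
      "U \<times> V \<subseteq> {z \<in> topspace (prod_topology rat_topology T). (case z of (q, h) \<Rightarrow> h q) \<in> W}"
    unfolding openin_prod_topology_alt by meson
  then have UVW: "v q \<in> W" if "q \<in> U" "v \<in> V" for q v using that by auto
  have "U \<subseteq> W" using UVW[OF _ UV(4)] by auto
  obtain P' where P': "qclopen P'" "P' \<subseteq> U" "P' \<noteq> {}" using qclopen_inside_qopen UV by blast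
  \<comment> \<open>A proper part of \<open>P'\<close> is taken so that \<open>W - P\<close> is
    nonempty, to match the nonempty complement of \<open>B \<union> D\<close>.\<close>
  obtain P where P: "qclopen P" "P \<subseteq> P'" "P \<noteq> {}" "P \<noteq> P'" using qclopen_proper_subset[OF P'(1,3)] by blast
  obtain g where g: "g \<in> carrier Homeo_Q" "g ` P = B" "g ` (- W) = D"
  proof (rule homeo_three_pieces[OF P(1) _ _ P(3) _ _ BD])
    show "qclopen (- W)" using W by simp
    show "P \<inter> - W = {}" "- W \<noteq> {}" using \<open>U \<subseteq> W\<close> P' P W by auto
    obtain y where "y \<in> P'" "y \<notin> P" using P by blast
    moreover from this have "y \<in> W" using \<open>U \<subseteq> W\<close> P' by blast
    ultimately show "P \<union> - W \<noteq> UNIV" by blast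
  qed
  have bg: "bij g" using g(1) by (simp add: Homeo_Q_iff)
  let ?i = "Hilbert_Choice.inv g"
  \<comment> \<open>The product inside the braces is the map "first \<open>g\<close>, then
    \<open>h\<close>, then \<open>?i\<close>". That it sends \<open>P\<close> into \<open>W\<close>
    means that \<open>h\<close> sends \<open>B = g\<close> P\<open>into\<close>g \<open>W\<close>,
    the complement of \<open>D\<close>.\<close>
  define N where "N = {h \<in> topspace T. (g \<otimes>\<^bsub>Homeo_Q\<^esub> h) \<otimes>\<^bsub>Homeo_Q\<^esub> ?i \<in> V}"
  have "continuous_map T T ((\<lambda>h. h \<otimes>\<^bsub>Homeo_Q\<^esub> ?i) \<circ> (\<lambda>h. g \<otimes>\<^bsub>Homeo_Q\<^esub> h))"
    using group_topology_lmult[OF gt g(1)] group_topology_rmult[OF gt Homeo_Q_inv[OF g(1)]]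
    by (rule continuous_map_compose)
  then have "openin T N"
    unfolding N_def using UV(2) by (auto simp: o_def intro: openin_continuous_map_preimage)
  moreover have "id \<in> N"
    using UV(4) bg top Homeo_Q_id by (simp add: N_def mult_Homeo_Q bij_is_inj)
  moreover have "h ` B \<inter> D = {}" if "h \<in> N" for h
  proof -
    have "?i \<circ> (h \<circ> g) \<in> V" using that by (simp add: N_def mult_Homeo_Q)
    then have "?i (h (g q)) \<in> W" if "q \<in> P" for q using UVW[of q] that P P' by fastforce
    then have "h (g q) \<in> g ` W" if "q \<in> P" for q
      using that bg by (metis bij_inv_eq_iff image_eqI)
    then have "h ` B \<subseteq> g ` W" using g(2) by auto
    moreover have "g ` W \<inter> g ` (- W) = {}" using bg by (auto simp: bij_def inj_def)
    ultimately show ?thesis using g(3) by auto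
  qed
  ultimately show ?thesis by blast
qed

text \<open>\<open>admissible_separate\<close> requires room outside the two sets, so it does not
  apply to \<open>A\<close> and \<open>- A\<close> themselves. Both are cut in two, and the four
  pairs of halves are separated one at a time.\<close>

lemma admissible_half_stable:
  assumes T: "admissible T" and A: "qclopen A"
  shows "\<exists>V. openin T V \<and> id \<in> V \<and> (\<forall>h\<in>V. h ` A \<subseteq> A)"
proof (cases "A = {} \<or> A = UNIV")
  case True
  then show ?thesis using topspace_admissible[OF T] Homeo_Q_id openin_topspace[of T] by auto
next
  case False
  have A': "qclopen (- A)" "- A \<noteq> {}" using A False by auto
  obtain P where P: "qclopen P" "P \<subseteq> A" "P \<noteq> {}" "P \<noteq> A" using qclopen_proper_subset A False by blast
  obtain Q where Q: "qclopen Q" "Q \<subseteq> - A" "Q \<noteq> {}" "Q \<noteq> - A" using qclopen_proper_subset[OF A'] by blast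
  have P': "qclopen (A - P)" and Q': "qclopen (- A - Q)" using qclopen_Diff A A' P Q by blast+
  have "\<exists>V. openin T V \<and> id \<in> V \<and> (\<forall>h\<in>V. h ` P \<inter> Q = {})"
    by (rule admissible_separate[OF T P(1) Q(1)]) (use P Q in auto)
  moreover have "\<exists>V. openin T V \<and> id \<in> V \<and> (\<forall>h\<in>V. h ` P \<inter> (- A - Q) = {})"
    by (rule admissible_separate[OF T P(1) Q']) (use P Q in auto)
  moreover have "\<exists>V. openin T V \<and> id \<in> V \<and> (\<forall>h\<in>V. h ` (A - P) \<inter> Q = {})"
    by (rule admissible_separate[OF T P' Q(1)]) (use P Q in auto)
  moreover have "\<exists>V. openin T V \<and> id \<in> V \<and> (\<forall>h\<in>V. h ` (A - P) \<inter> (- A - Q) = {})"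
    by (rule admissible_separate[OF T P' Q']) (use P Q in auto)
  ultimately obtain V1 V2 V3 V4 where V: "openin T V1" "openin T V2" "openin T V3" "openin T V4"
     "id \<in> V1" "id \<in> V2" "id \<in> V3" "id \<in> V4"
     "\<And>h. h \<in> V1 \<Longrightarrow> h ` P \<inter> Q = {}" "\<And>h. h \<in> V2 \<Longrightarrow> h ` P \<inter> (- A - Q) = {}"
     "\<And>h. h \<in> V3 \<Longrightarrow> h ` (A - P) \<inter> Q = {}" "\<And>h. h \<in> V4 \<Longrightarrow> h ` (A - P) \<inter> (- A - Q) = {}"
    by metis
  have "h ` A \<subseteq> A" if "h \<in> V1 \<inter> V2 \<inter> V3 \<inter> V4" for h
  proof
    fix y assume "y \<in> h ` A"
    then obtain x where "x \<in> A" "y = h x" by blast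
    then show "y \<in> A" using V(9-12)[of h] that by blast
  qed
  then show ?thesis using V(1-8) by (intro exI[of _ "V1 \<inter> V2 \<inter> V3 \<inter> V4"]) auto
qed

text \<open>If \<open>h\<close> is close to \<open>f\<close>, then \<open>h\<close> followed by the
  inverse of \<open>f\<close> is close to the identity and maps \<open>A\<close> into
  \<open>A\<close> and \<open>- A\<close> into \<open>- A\<close>. For a bijection the two
  inclusions together give equality.\<close>

lemma openin_transporter:
  assumes T: "admissible T" and A: "qclopen A"
  shows "openin T {h \<in> carrier Homeo_Q. h ` A = B}"
proof (subst openin_subopen, intro ballI)
  have gt: "group_topology Homeo_Q T" using T by (simp add: admissible_def)
  fix f assume "f \<in> {h \<in> carrier Homeo_Q. h ` A = B}"
  then have f: "f \<in> carrier Homeo_Q" "f ` A = B" by auto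
  then have bf: "bij f" by (simp add: Homeo_Q_iff)
  obtain V W where V: "openin T V" "id \<in> V" "\<And>h. h \<in> V \<Longrightarrow> h ` A \<subseteq> A"
    and W: "openin T W" "id \<in> W" "\<And>h. h \<in> W \<Longrightarrow> h ` (- A) \<subseteq> - A"
    using admissible_half_stable[OF T A] admissible_half_stable[OF T, of "- A"] A by auto
  let ?i = "Hilbert_Choice.inv f"
  define N where "N = {h \<in> topspace T. h \<otimes>\<^bsub>Homeo_Q\<^esub> ?i \<in> V \<inter> W}"
  have "openin T N" unfolding N_def
    by (rule openin_continuous_map_preimage[OF group_topology_rmult[OF gt Homeo_Q_inv[OF f(1)]] openin_Int[OF V(1) W(1)]])
  moreover have "f \<in> N"
    using V W f bf topspace_admissible[OF T] by (simp add: N_def mult_Homeo_Q bij_is_inj)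
  moreover have "N \<subseteq> {h \<in> carrier Homeo_Q. h ` A = B}"
  proof
    fix h assume "h \<in> N"
    then have h: "h \<in> carrier Homeo_Q" "?i \<circ> h \<in> V" "?i \<circ> h \<in> W"
      using topspace_admissible[OF T] by (auto simp: N_def mult_Homeo_Q)
    then have "bij (?i \<circ> h)" using bij_comp[OF _ bij_imp_bij_inv[OF bf], of h] by (simp add: Homeo_Q_iff)
    then have "(?i \<circ> h) ` (- A) = - ((?i \<circ> h) ` A)" by (rule bij_image_Compl_eq)
    then have "(?i \<circ> h) ` A = A" using V(3)[OF h(2)] W(3)[OF h(3)] by blast
    then have "(f \<circ> (?i \<circ> h)) ` A = B" unfolding image_comp[symmetric] using f(2) by simp
    moreover have "f \<circ> (?i \<circ> h) = h" using bf by (simp add: fun_eq_iff bij_is_surj surj_f_inv_f)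
    ultimately show "h \<in> {h \<in> carrier Homeo_Q. h ` A = B}" using h(1) by simp
  qed
  ultimately show "\<exists>N. openin T N \<and> f \<in> N \<and> N \<subseteq> {h \<in> carrier Homeo_Q. h ` A = B}" by blast
qed

subsection \<open>Stabilizers of families of clopen sets\<close>

text \<open>A partition and an ultrafilter are both families of sets, so one notion of stabilizer,
  and one maximality argument, serves for both.\<close>

definition family_stab :: "rat set set \<Rightarrow> (rat \<Rightarrow> rat) set" where
  "family_stab p = {h \<in> carrier Homeo_Q. \<forall>A. h ` A \<in> p \<longleftrightarrow> A \<in> p}"

lemma subgroup_family_stab: "subgroup (family_stab p) Homeo_Q"
  unfolding subgroup_Homeo_Q_iff
proof (intro conjI ballI)
  show "family_stab p \<subseteq> carrier Homeo_Q" "id \<in> family_stab p"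
    using Homeo_Q_id by (auto simp: family_stab_def)
  fix f assume f: "f \<in> family_stab p"
  then have fc: "f \<in> carrier Homeo_Q" and fp: "\<And>A. f ` A \<in> p \<longleftrightarrow> A \<in> p"
    by (simp_all add: family_stab_def)
  then have "bij f" by (simp add: Homeo_Q_iff)
  then have "Hilbert_Choice.inv f ` A \<in> p \<longleftrightarrow> A \<in> p" for A
    using fp[of "Hilbert_Choice.inv f ` A"] by (simp only: image_f_inv_f bij_is_surj)
  then show "Hilbert_Choice.inv f \<in> family_stab p"
    using Homeo_Q_inv[OF fc] by (simp add: family_stab_def)
  fix g assume "g \<in> family_stab p"
  then have gc: "g \<in> carrier Homeo_Q" and gp: "\<And>A. g ` A \<in> p \<longleftrightarrow> A \<in> p"
    by (simp_all add: family_stab_def)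
  have "(g \<circ> f) ` A \<in> p \<longleftrightarrow> A \<in> p" for A
    unfolding image_comp[symmetric] gp fp ..
  then show "g \<circ> f \<in> family_stab p"
    using Homeo_Q_comp[OF fc gc] by (simp add: family_stab_def)
qed

lemma closedin_family_stab:
  assumes T: "admissible T" and p: "\<And>A. A \<in> p \<Longrightarrow> qclopen A"
  shows "closedin T (family_stab p)"
proof -
  have "topspace T - family_stab p =
      (\<Union>(A, B) \<in> {(A, B). qclopen A \<and> (A \<in> p) \<noteq> (B \<in> p)}. {h \<in> carrier Homeo_Q. h ` A = B})" (is "?L = ?R")
  proof
    show "?L \<subseteq> ?R"
    proof
      fix h assume "h \<in> ?L"
      then obtain A where h: "h \<in> carrier Homeo_Q" and A: "(A \<in> p) \<noteq> (h ` A \<in> p)"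
        using topspace_admissible[OF T] by (auto simp: family_stab_def)
      \<comment> \<open>One of \<open>A\<close> and its image lies in \<open>p\<close> and so is
        clopen; homeomorphisms pass this on to the other.\<close>
      have "qclopen A" using p A qclopen_image[OF h] by blast
      then show "h \<in> ?R" using h A by blast
    qed
    show "?R \<subseteq> ?L"
    proof
      fix h assume "h \<in> ?R"
      then obtain A where "h \<in> carrier Homeo_Q" "(A \<in> p) \<noteq> (h ` A \<in> p)" by blast
      then show "h \<in> ?L" using topspace_admissible[OF T] by (auto simp: family_stab_def)
    qed
  qed
  moreover have "openin T ?R"
    by (intro openin_Union) (auto intro: openin_transporter[OF T])
  moreover have "family_stab p \<subseteq> topspace T" by (auto simp: family_stab_def topspace_admissible[OF T])
  ultimately show ?thesis by (simp add: closedin_def)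
qed

lemma image_mem_image_iff: "bij g \<Longrightarrow> g ` A \<in> (`) g ` p \<longleftrightarrow> A \<in> p"
  by (auto simp: bij_is_inj inj_image_eq_iff)

text \<open>The stabilizer of a translated family is a conjugate of the original stabilizer.\<close>

lemma family_stab_image:
  assumes g: "g \<in> carrier Homeo_Q" and k: "k \<in> family_stab ((`) g ` p)"
  shows "Hilbert_Choice.inv g \<circ> (k \<circ> g) \<in> family_stab p"
proof -
  have bg: "bij g" using g by (simp add: Homeo_Q_iff)
  have mem: "g ` A \<in> (`) g ` p \<longleftrightarrow> A \<in> p" for A
    using image_mem_image_iff[OF bg] .
  have "(Hilbert_Choice.inv g \<circ> (k \<circ> g)) ` A \<in> p \<longleftrightarrow> A \<in> p" for A
  proof -
    have "g \<circ> (Hilbert_Choice.inv g \<circ> (k \<circ> g)) = k \<circ> g"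
      using bg by (simp add: fun_eq_iff bij_is_surj surj_f_inv_f)
    then have "g ` ((Hilbert_Choice.inv g \<circ> (k \<circ> g)) ` A) = k ` (g ` A)"
      unfolding image_comp by (rule arg_cong)
    then show ?thesis using mem k unfolding family_stab_def by (metis (mono_tags, lifting) mem_Collect_eq)
  qed
  moreover have "k \<in> carrier Homeo_Q" using k by (simp add: family_stab_def)
  ultimately show ?thesis using g Homeo_Q_inv Homeo_Q_comp by (simp add: family_stab_def)
qed

text \<open>A subgroup strictly above the stabilizer of \<open>p\<close> contains some
  \<open>g\<close> that moves \<open>p\<close> to a different member of \<open>\<Omega>\<close>. It
  also contains the stabilizer of that member, a conjugate by \<open>g\<close>, so by
  \<open>generate\<close> it is everything. Two distinct members with equal stabilizers would
  likewise make that stabilizer the whole group, against \<open>moved\<close>.\<close>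

lemma maximal_family_stab:
  assumes invariant: "\<And>p g. p \<in> \<Omega> \<Longrightarrow> g \<in> carrier Homeo_Q \<Longrightarrow> (`) g ` p \<in> \<Omega>"
    and moved: "\<And>p. p \<in> \<Omega> \<Longrightarrow> family_stab p \<noteq> carrier Homeo_Q"
    and generate: "\<And>p q H. p \<in> \<Omega> \<Longrightarrow> q \<in> \<Omega> \<Longrightarrow> p \<noteq> q \<Longrightarrow> subgroup H Homeo_Q \<Longrightarrow>
      family_stab p \<subseteq> H \<Longrightarrow> family_stab q \<subseteq> H \<Longrightarrow> H = carrier Homeo_Q"
  shows "p \<in> \<Omega> \<Longrightarrow> maximal_subgroup (family_stab p) Homeo_Q" and "inj_on family_stab \<Omega>"
proof -
  show "inj_on family_stab \<Omega>"
  proof (rule inj_onI, rule ccontr)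
    fix p q assume "p \<in> \<Omega>" "q \<in> \<Omega>" "family_stab p = family_stab q" "p \<noteq> q"
    then show False using generate[of p q "family_stab p"] subgroup_family_stab moved by auto
  qed
next
  assume p: "p \<in> \<Omega>"
  have "H = carrier Homeo_Q" if H: "subgroup H Homeo_Q" "family_stab p \<subset> H" for H
  proof -
    obtain g where g: "g \<in> H" "g \<notin> family_stab p" using H by blast
    have gc: "g \<in> carrier Homeo_Q" using g H subgroup_Homeo_QD by blast
    then have bg: "bij g" by (simp add: Homeo_Q_iff)
    have "(`) g ` p \<noteq> p"
    proof
      assume "(`) g ` p = p"
      then have "g ` A \<in> p \<longleftrightarrow> A \<in> p" for A
        using image_mem_image_iff[OF bg, of A p] by simp
      then show False using g gc by (simp add: family_stab_def)
    qed
    moreover have "family_stab ((`) g ` p) \<subseteq> H"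
    proof
      fix k assume "k \<in> family_stab ((`) g ` p)"
      then have "Hilbert_Choice.inv g \<circ> (k \<circ> g) \<in> H" using family_stab_image[OF gc] H(2) by blast
      moreover have "bij (Hilbert_Choice.inv g)" using bg by (rule bij_imp_bij_inv)
      ultimately have "k \<circ> g \<in> H"
        using subgroup_comp_cancel[OF H(1)] subgroup_Homeo_QD(4)[OF H(1) g(1)] by blast
      then have "(k \<circ> g) \<circ> Hilbert_Choice.inv g \<in> H"
        using subgroup_Homeo_QD(3,4)[OF H(1)] g(1) by blast
      moreover have "(k \<circ> g) \<circ> Hilbert_Choice.inv g = k"
        using bg by (simp add: fun_eq_iff bij_is_surj surj_f_inv_f)
      ultimately show "k \<in> H" by simp
    qed
    ultimately show ?thesis using generate[OF p invariant[OF p gc]] H by blast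
  qed
  then show "maximal_subgroup (family_stab p) Homeo_Q"
    unfolding maximal_subgroup_def using subgroup_family_stab moved[OF p] by blast
qed

lemma generate_cover:
  assumes "subgroup H Homeo_Q" "qclopen A" "qclopen B" "A \<inter> B \<noteq> {}" "A \<union> B = UNIV"
    "supported A \<subseteq> H" "supported B \<subseteq> H"
  shows "H = carrier Homeo_Q"
  using supported_generate[of A B H] assms subgroup_Homeo_QD(1)[of H] by (auto simp: supported_UNIV)

subsection \<open>Partitions into two clopen sets\<close>

text \<open>The pair is unordered so that its stabilizer includes the maps exchanging
  \<open>A\<close> and \<open>- A\<close>; the stabilizer of \<open>A\<close> alone is properly
  contained in it and not maximal.\<close>

definition clopen_partitions :: "rat set set set" where
  "clopen_partitions = {{A, - A} | A. qclopen A \<and> A \<noteq> {} \<and> A \<noteq> UNIV}"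

lemma supported_subset_partition_stab:
  assumes "qclopen A"
  shows "supported A \<subseteq> family_stab {A, - A}"
proof
  fix h assume h: "h \<in> supported A"
  then have c: "h \<in> carrier Homeo_Q" "bij h" by (simp_all add: supported_def Homeo_Q_iff)
  have "h ` A = A" using supported_image[OF h subset_refl] .
  moreover from this have "h ` (- A) = - A" using c(2) by (simp add: bij_image_Compl_eq)
  ultimately have "h ` B \<in> {A, - A} \<longleftrightarrow> B \<in> {A, - A}" for B
    using inj_image_eq_iff[OF bij_is_inj[OF c(2)], of B A] inj_image_eq_iff[OF bij_is_inj[OF c(2)], of B "- A"]
    by auto
  with c(1) show "h \<in> family_stab {A, - A}" by (simp add: family_stab_def)
qed

text \<open>Of two distinct partitions, some cell of the second meets both cells of the first;
  otherwise the cells would coincide.\<close>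

lemma partition_generate:
  assumes H: "subgroup H Homeo_Q" and A: "qclopen A" "A \<noteq> {}" "A \<noteq> UNIV" and B: "qclopen B" "B \<noteq> {}" "B \<noteq> UNIV"
    and ne: "{A, - A} \<noteq> {B, - B}" and sub: "family_stab {A, - A} \<subseteq> H" "family_stab {B, - B} \<subseteq> H"
  shows "H = carrier Homeo_Q"
proof -
  \<comment> \<open>\<open>D\<close> overlaps \<open>C\<close>, so everything supported in
    \<open>C \<union> D\<close> is reached; this union overlaps \<open>- C\<close> because
    \<open>D\<close> does, and together they cover the rationals.\<close>
  have three_cells: "H = carrier Homeo_Q"
    if C: "qclopen C" "supported C \<subseteq> H" "supported (- C) \<subseteq> H"
      and D: "qclopen D" "supported D \<subseteq> H" "C \<inter> D \<noteq> {}" "- C \<inter> D \<noteq> {}" for C D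
  proof -
    have "supported (C \<union> D) \<subseteq> H" using supported_generate[OF C(1) D(1) D(3) H C(2) D(2)] .
    moreover have "qclopen (C \<union> D)" "qclopen (- C)" using C(1) D(1) qclopen_Un by auto
    moreover have "- C \<inter> (C \<union> D) \<noteq> {}" "- C \<union> (C \<union> D) = UNIV" using D(4) by auto
    ultimately show ?thesis using generate_cover[OF H] C(3) by blast
  qed
  have supA: "supported A \<subseteq> H" "supported (- A) \<subseteq> H"
    using supported_subset_partition_stab[of A] supported_subset_partition_stab[of "- A"] A sub
    by (auto simp: insert_commute)
  have supB: "supported B \<subseteq> H" "supported (- B) \<subseteq> H"
    using supported_subset_partition_stab[of B] supported_subset_partition_stab[of "- B"] B sub
    by (auto simp: insert_commute)
  show ?thesis
  proof (cases "A \<inter> B \<noteq> {} \<and> - A \<inter> B \<noteq> {}")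
    case True
    then show ?thesis using three_cells[OF A(1) supA B(1) supB(1)] by blast
  next
    case False
    have "A \<inter> - B \<noteq> {} \<and> - A \<inter> - B \<noteq> {}"
    proof (rule ccontr)
      assume "\<not> ?thesis"
      then have "B = A \<or> B = - A" using False A B by blast
      then show False using ne by auto
    qed
    then show ?thesis using three_cells[OF A(1) supA _ supB(2)] B(1) by auto
  qed
qed

lemma partition_stab_maximal:
  shows "p \<in> clopen_partitions \<Longrightarrow> maximal_subgroup (family_stab p) Homeo_Q"
    and "inj_on family_stab clopen_partitions"
proof -
  have inv: "(`) g ` p \<in> clopen_partitions" if p: "p \<in> clopen_partitions" and g: "g \<in> carrier Homeo_Q" for p g
  proof -
    obtain A where A: "p = {A, - A}" "qclopen A" "A \<noteq> {}" "A \<noteq> UNIV" using p by (auto simp: clopen_partitions_def)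
    have bg: "bij g" using g by (simp add: Homeo_Q_iff)
    then have "(`) g ` p = {g ` A, - g ` A}" by (simp add: A bij_image_Compl_eq)
    moreover have "qclopen (g ` A)" using qclopen_image[OF g] A by blast
    moreover have "g ` A \<noteq> UNIV" using bg A(4) by (metis bij_is_inj bij_is_surj inj_image_eq_iff)
    ultimately show ?thesis using A unfolding clopen_partitions_def by blast
  qed
  have moved: "family_stab p \<noteq> carrier Homeo_Q" if p: "p \<in> clopen_partitions" for p
  proof
    assume eq: "family_stab p = carrier Homeo_Q"
    obtain A where A: "p = {A, - A}" "qclopen A" "A \<noteq> {}" "A \<noteq> UNIV" using p by (auto simp: clopen_partitions_def)
    \<comment> \<open>Being a nonempty proper part of \<open>A\<close>, the set \<open>P\<close> is
      no cell of the partition, yet some homeomorphism maps \<open>A\<close> onto it.\<close>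
    obtain P where P: "qclopen P" "P \<subseteq> A" "P \<noteq> {}" "P \<noteq> A" using qclopen_proper_subset A by blast
    have "qclopen UNIV" using openin_topspace[of rat_topology] by auto
    then obtain f where f: "f \<in> supported UNIV" "f ` A = P"
      using supported_move[of UNIV A P] A P by blast
    then have "f \<in> family_stab p" using eq by (simp add: supported_UNIV)
    then have "f ` A \<in> p" using A(1) by (simp add: family_stab_def)
    then show False using f(2) P A(1) by auto
  qed
  have gen: "H = carrier Homeo_Q"
    if "p \<in> clopen_partitions" "q \<in> clopen_partitions" "p \<noteq> q" "subgroup H Homeo_Q"
      "family_stab p \<subseteq> H" "family_stab q \<subseteq> H" for p q H
    using that partition_generate[of H] unfolding clopen_partitions_def by blast
  show "maximal_subgroup (family_stab p) Homeo_Q" if p: "p \<in> clopen_partitions"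
    by (rule maximal_family_stab(1)[OF _ _ _ p]) (fact inv moved gen)+
  show "inj_on family_stab clopen_partitions"
    by (rule maximal_family_stab(2)) (fact inv moved gen)+
qed

text \<open>Bijections respect complements, so the partition is preserved as soon as
  \<open>A\<close> goes to \<open>A\<close> or to \<open>- A\<close>: the stabilizer is a union of
  two transporters.\<close>

lemma openin_partition_stab:
  assumes T: "admissible T" and p: "p \<in> clopen_partitions"
  shows "openin T (family_stab p)"
proof -
  obtain A where A: "p = {A, - A}" "qclopen A" using p by (auto simp: clopen_partitions_def)
  have "family_stab p = {h \<in> carrier Homeo_Q. h ` A = A} \<union> {h \<in> carrier Homeo_Q. h ` A = - A}"
  proof
    show "family_stab p \<subseteq> {h \<in> carrier Homeo_Q. h ` A = A} \<union> {h \<in> carrier Homeo_Q. h ` A = - A}"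
    proof
      fix h assume "h \<in> family_stab p"
      then have "h \<in> carrier Homeo_Q" "h ` A \<in> p" by (simp_all add: family_stab_def A(1))
      then show "h \<in> {h \<in> carrier Homeo_Q. h ` A = A} \<union> {h \<in> carrier Homeo_Q. h ` A = - A}"
        by (simp add: A(1))
    qed
    have "h \<in> family_stab p" if h: "h \<in> carrier Homeo_Q" "h ` A \<in> {A, - A}" for h
    proof -
      have bh: "bij h" using h by (simp add: Homeo_Q_iff)
      have "h ` (- A) = - h ` A" using bh by (rule bij_image_Compl_eq)
      then have "(`) h ` p = {h ` A, - h ` A}" by (simp add: A(1))
      then have "(`) h ` p = p" using h(2) unfolding A(1) by force
      then have "h ` B \<in> p \<longleftrightarrow> B \<in> p" for B
        using image_mem_image_iff[OF bh, of B p] by simp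
      then show ?thesis using h(1) by (simp add: family_stab_def)
    qed
    then show "{h \<in> carrier Homeo_Q. h ` A = A} \<union> {h \<in> carrier Homeo_Q. h ` A = - A} \<subseteq> family_stab p" by blast
  qed
  then show ?thesis using openin_transporter[OF T A(2)] by auto
qed

subsection \<open>Clopen ultrafilters\<close>

definition fip :: "'a set set \<Rightarrow> bool" where
  "fip F \<longleftrightarrow> (\<forall>X\<subseteq>F. finite X \<longrightarrow> \<Inter>X \<noteq> {})"

text \<open>Zorn's lemma gives a maximal \<open>u\<close>. If it contained neither \<open>A\<close>
  nor \<open>- A\<close>, finite parts of \<open>u\<close> would have intersections missing
  \<open>A\<close> and \<open>- A\<close> respectively, so their union would have empty
  intersection.\<close>

lemma fip_extend_maximal:
  assumes "fip F"
  obtains u where "F \<subseteq> u" "fip u" "\<And>A. A \<in> u \<or> - A \<in> u"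
proof -
  define \<A> where "\<A> = {u. F \<subseteq> u \<and> fip u}"
  have "\<exists>u\<in>\<A>. \<forall>X\<in>\<A>. u \<subseteq> X \<longrightarrow> X = u"
  proof (rule subset_Zorn_nonempty)
    show "\<A> \<noteq> {}" using assms by (auto simp: \<A>_def)
    fix \<C> assume C: "\<C> \<noteq> {}" "subset.chain \<A> \<C>"
    then have CA: "\<C> \<subseteq> \<A>" by (auto simp: subset.chain_def)
    have "\<Inter>X \<noteq> {}" if X: "X \<subseteq> \<Union>\<C>" "finite X" for X
    proof -
      obtain c where "c \<in> \<C>" "X \<subseteq> c"
        using finite_subset_Union_chain[OF X(2,1) C] by blast
      then show ?thesis using CA X(2) by (auto simp: \<A>_def fip_def)
    qed
    then have "fip (\<Union>\<C>)" by (simp add: fip_def)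
    moreover have "F \<subseteq> \<Union>\<C>" using C(1) CA unfolding \<A>_def by blast
    ultimately show "\<Union>\<C> \<in> \<A>" by (simp add: \<A>_def)
  qed
  then obtain u where u: "u \<in> \<A>" "\<And>X. X \<in> \<A> \<Longrightarrow> u \<subseteq> X \<Longrightarrow> X = u" by blast
  then have Fu: "F \<subseteq> u" "fip u" by (auto simp: \<A>_def)
  have missing: "\<exists>X\<subseteq>u. finite X \<and> \<Inter>X \<inter> A = {}" if "A \<notin> u" for A
  proof -
    have "\<not> fip (insert A u)" using u(2)[of "insert A u"] that Fu(1) by (auto simp: \<A>_def)
    then obtain X where X: "X \<subseteq> insert A u" "finite X" "\<Inter>X = {}" by (auto simp: fip_def)
    have "\<Inter>(X - {A}) \<inter> A \<subseteq> \<Inter>X" by blast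
    then show ?thesis using X by (intro exI[of _ "X - {A}"]) auto
  qed
  have "A \<in> u \<or> - A \<in> u" for A
  proof (rule ccontr)
    assume "\<not> ?thesis"
    then obtain X Y where XY: "X \<subseteq> u" "finite X" "\<Inter>X \<inter> A = {}" "Y \<subseteq> u" "finite Y" "\<Inter>Y \<inter> - A = {}"
      using missing by metis
    then have "\<Inter>(X \<union> Y) = {}" by blast
    then show False using XY Fu(2) unfolding fip_def by (metis Un_least finite_UnI)
  qed
  with Fu that show ?thesis by blast
qed

text \<open>Ultrafilters of the algebra of clopen sets; the filter closure properties follow from
  these conditions by \<open>clopen_ultrafilter_entails\<close>.\<close>

definition clopen_ultrafilters :: "rat set set set" where
  "clopen_ultrafilters = {p. (\<forall>A\<in>p. qclopen A) \<and> fip p \<and> (\<forall>A. qclopen A \<longrightarrow> A \<in> p \<or> - A \<in> p)}"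

lemma clopen_ultrafiltersD:
  assumes "p \<in> clopen_ultrafilters"
  shows "A \<in> p \<Longrightarrow> qclopen A" "X \<subseteq> p \<Longrightarrow> finite X \<Longrightarrow> \<Inter>X \<noteq> {}"
    "qclopen A \<Longrightarrow> A \<in> p \<or> - A \<in> p"
  using assms by (simp_all add: clopen_ultrafilters_def fip_def)

lemma clopen_ultrafilter_entails:
  assumes p: "p \<in> clopen_ultrafilters" and X: "X \<subseteq> p" "finite X" "\<Inter>X \<subseteq> A" and A: "qclopen A"
  shows "A \<in> p"
proof (rule ccontr)
  assume "A \<notin> p"
  then have "- A \<in> p" using clopen_ultrafiltersD(3)[OF p A] by blast
  then have "\<Inter>(insert (- A) X) \<noteq> {}" using X by (intro clopen_ultrafiltersD(2)[OF p]) auto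
  then show False using X(3) by auto
qed

lemma clopen_ultrafilter_disjoint:
  assumes p: "p \<in> clopen_ultrafilters" and "A \<in> p" "B \<in> p"
  shows "A \<inter> B \<noteq> {}"
proof -
  have "\<Inter>{A, B} \<noteq> {}" using assms(2,3) by (intro clopen_ultrafiltersD(2)[OF p]) auto
  then show ?thesis by simp
qed

text \<open>A map supported in \<open>C\<close> leaves the trace of every set on \<open>- C\<close>
  unchanged, and since \<open>- C\<close> belongs to \<open>p\<close>, this trace decides membership
  in \<open>p\<close>.\<close>

lemma supported_subset_ultrafilter_stab:
  assumes p: "p \<in> clopen_ultrafilters" and C: "- C \<in> p"
  shows "supported C \<subseteq> family_stab p"
proof
  fix h assume h: "h \<in> supported C"
  then have c: "h \<in> carrier Homeo_Q" "bij h" and out: "\<And>x. x \<notin> C \<Longrightarrow> h x = x"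
    by (auto simp: supported_def Homeo_Q_iff)
  have "h ` C = C" using supported_image[OF h subset_refl] .
  have same: "h ` A \<inter> - C = A \<inter> - C" for A
  proof (intro equalityI subsetI)
    fix x assume "x \<in> h ` A \<inter> - C"
    then obtain a where a: "a \<in> A" "x = h a" "h a \<notin> C" by blast
    then have "a \<notin> C" using \<open>h ` C = C\<close> by blast
    then show "x \<in> A \<inter> - C" using a out by simp
  next
    fix x assume x: "x \<in> A \<inter> - C"
    then have "h x = x" using out by blast
    then show "x \<in> h ` A \<inter> - C" using x by (metis IntD1 IntD2 IntI image_eqI)
  qed
  have clo: "\<And>A. A \<in> p \<Longrightarrow> qclopen A" using clopen_ultrafiltersD(1)[OF p] .
  have "h ` A \<in> p \<longleftrightarrow> A \<in> p" for A
  proof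
    assume A: "h ` A \<in> p"
    then have "qclopen A" using clo qclopen_image[OF c(1)] by blast
    then show "A \<in> p"
      using same[of A] A C by (intro clopen_ultrafilter_entails[OF p, of "{h ` A, - C}"]) auto
  next
    assume A: "A \<in> p"
    then have "qclopen (h ` A)" using clo qclopen_image[OF c(1)] by blast
    then show "h ` A \<in> p"
      using same[of A] A C by (intro clopen_ultrafilter_entails[OF p, of "{A, - C}"]) auto
  qed
  with c(1) show "h \<in> family_stab p" by (simp add: family_stab_def)
qed

text \<open>Take \<open>A\<close> in one ultrafilter with \<open>- A\<close> in the other, and
  shrink \<open>A\<close> to a proper part \<open>B\<close> still in the first. Then
  \<open>- B\<close> and \<open>A\<close> cover the rationals and overlap, and maps supported in
  \<open>- B\<close> stabilize the first ultrafilter, those supported in \<open>A\<close> the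
  second.\<close>

lemma ultrafilter_generate:
  assumes p: "p \<in> clopen_ultrafilters" and q: "q \<in> clopen_ultrafilters" and ne: "p \<noteq> q"
    and H: "subgroup H Homeo_Q" "family_stab p \<subseteq> H" "family_stab q \<subseteq> H"
  shows "H = carrier Homeo_Q"
proof -
  have *: "H = carrier Homeo_Q"
    if p: "p \<in> clopen_ultrafilters" and q: "q \<in> clopen_ultrafilters" and A: "A \<in> p" "- A \<in> q"
      and H: "family_stab p \<subseteq> H" "family_stab q \<subseteq> H" for p q A
  proof -
    have clo: "qclopen A" by (rule clopen_ultrafiltersD(1)[OF p A(1)])
    have "A \<noteq> {}" using clopen_ultrafilter_disjoint[OF p A(1) A(1)] by simp
    then obtain P where P: "qclopen P" "P \<subseteq> A" "P \<noteq> {}" "P \<noteq> A" using qclopen_proper_subset clo by blast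
    have "P \<in> p \<or> A - P \<in> p"
    proof (rule disjCI)
      assume "A - P \<notin> p"
      then have "- (A - P) \<in> p" using clopen_ultrafiltersD(3)[OF p qclopen_Diff[OF clo P(1)]] by blast
      then show "P \<in> p"
        using A(1) P by (intro clopen_ultrafilter_entails[OF p, of "{A, - (A - P)}"]) auto
    qed
    moreover have "qclopen (A - P)" "A - P \<noteq> A" using P qclopen_Diff[OF clo P(1)] by auto
    ultimately obtain B where B: "B \<in> p" "qclopen B" "B \<subseteq> A" "B \<noteq> A"
      using P by blast
    have "supported (- B) \<subseteq> H" using supported_subset_ultrafilter_stab[OF p, of "- B"] B H by auto
    moreover have "supported A \<subseteq> H" using supported_subset_ultrafilter_stab[OF q, of A] A H by auto
    moreover have "- B \<inter> A \<noteq> {}" "- B \<union> A = UNIV" using B by auto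
    ultimately show ?thesis using generate_cover[OF \<open>subgroup H Homeo_Q\<close>, of "- B" A] B(2) clo by simp
  qed
  from ne consider A where "A \<in> p" "A \<notin> q" | A where "A \<in> q" "A \<notin> p" by blast
  then show ?thesis
  proof cases
    case (1 A)
    then have "- A \<in> q" using clopen_ultrafiltersD(1)[OF p, of A] clopen_ultrafiltersD(3)[OF q, of A] by blast
    with 1 show ?thesis using *[OF p q] H by blast
  next
    case (2 A)
    then have "- A \<in> p" using clopen_ultrafiltersD(1)[OF q, of A] clopen_ultrafiltersD(3)[OF p, of A] by blast
    with 2 show ?thesis using *[OF q p] H by blast
  qed
qed

lemma ultrafilter_stab_maximal:
  shows "p \<in> clopen_ultrafilters \<Longrightarrow> maximal_subgroup (family_stab p) Homeo_Q"
    and "inj_on family_stab clopen_ultrafilters"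
proof -
  have inv: "(`) g ` p \<in> clopen_ultrafilters" if p: "p \<in> clopen_ultrafilters" and g: "g \<in> carrier Homeo_Q" for p g
  proof -
    have bg: "bij g" using g by (simp add: Homeo_Q_iff)
    have "qclopen A" if A: "A \<in> (`) g ` p" for A
    proof -
      obtain B where "B \<in> p" "A = g ` B" using A by blast
      then show ?thesis using clopen_ultrafiltersD(1)[OF p] qclopen_image[OF g] by simp
    qed
    moreover have "fip ((`) g ` p)" unfolding fip_def
    proof (intro allI impI)
      fix X assume "X \<subseteq> (`) g ` p" "finite X"
      then obtain Y where Y: "Y \<subseteq> p" "finite Y" "X = (`) g ` Y" by (metis finite_subset_image)
      have "\<Inter>Y \<noteq> {}" by (rule clopen_ultrafiltersD(2)[OF p Y(1,2)])
      then obtain x where "\<And>A. A \<in> Y \<Longrightarrow> x \<in> A" by auto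
      then have "g x \<in> \<Inter>X" unfolding Y(3) by auto
      then show "\<Inter>X \<noteq> {}" by auto
    qed
    moreover have "A \<in> (`) g ` p \<or> - A \<in> (`) g ` p" if A: "qclopen A" for A
    proof -
      define B where "B = Hilbert_Choice.inv g ` A"
      have gB: "g ` B = A" unfolding B_def using bg by (simp add: image_f_inv_f bij_is_surj)
      then have "qclopen B" using A qclopen_image[OF g] by blast
      then have "B \<in> p \<or> - B \<in> p" by (rule clopen_ultrafiltersD(3)[OF p])
      moreover have "g ` (- B) = - A" using bij_image_Compl_eq[OF bg] gB by simp
      ultimately show ?thesis using gB by blast
    qed
    ultimately show ?thesis by (simp add: clopen_ultrafilters_def)
  qed
  have moved: "family_stab p \<noteq> carrier Homeo_Q" if p: "p \<in> clopen_ultrafilters" for p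
  proof
    assume eq: "family_stab p = carrier Homeo_Q"
    have U: "qclopen UNIV" using openin_topspace[of rat_topology] by auto
    obtain P where P: "qclopen P" "P \<noteq> {}" "P \<noteq> UNIV"
      by (rule qclopen_proper_subset[OF U]) auto
    have nP: "- P \<noteq> {}" "- P \<noteq> UNIV" "qclopen (- P)" using P by auto
    \<comment> \<open>Some \<open>f\<close> carries \<open>P\<close> to its complement, whereas
      exactly one of the two belongs to \<open>p\<close>.\<close>
    obtain f where f: "f \<in> supported UNIV" "f ` P = - P"
      by (rule supported_move[OF U P(1) _ P(2,3) nP(3) _ nP(1,2)]) auto
    then have "f \<in> family_stab p" using eq by (simp add: supported_UNIV)
    then have "f ` P \<in> p \<longleftrightarrow> P \<in> p" by (simp add: family_stab_def)
    then have "- P \<in> p \<longleftrightarrow> P \<in> p" by (simp only: f(2))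
    moreover have "P \<in> p \<or> - P \<in> p" using clopen_ultrafiltersD(3)[OF p P(1)] .
    ultimately show False using clopen_ultrafilter_disjoint[OF p, of P "- P"] by blast
  qed
  show "maximal_subgroup (family_stab p) Homeo_Q" if p: "p \<in> clopen_ultrafilters"
    by (rule maximal_family_stab(1)[OF _ _ _ p]) (fact inv moved ultrafilter_generate)+
  show "inj_on family_stab clopen_ultrafilters"
    by (rule maximal_family_stab(2)) (fact inv moved ultrafilter_generate)+
qed

subsection \<open>An independent family of clopen sets\<close>

definition independent_family :: "('i \<Rightarrow> 'a set) \<Rightarrow> bool" where
  "independent_family C \<longleftrightarrow>
     (\<forall>S N. finite S \<longrightarrow> finite N \<longrightarrow> S \<inter> N = {} \<longrightarrow> (\<exists>x. (\<forall>i\<in>S. x \<in> C i) \<and> (\<forall>i\<in>N. x \<notin> C i)))"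

lemma independent_familyD:
  assumes "independent_family C" "finite S" "finite N" "S \<inter> N = {}"
  shows "\<exists>x. (\<forall>i\<in>S. x \<in> C i) \<and> (\<forall>i\<in>N. x \<notin> C i)"
  using assms by (simp add: independent_family_def)

text \<open>The pair \<open>(F, G)\<close> codes a finite set together with a finite collection of its subsets.\<close>

lemma independent_family_codes:
  "independent_family (\<lambda>X::nat set. {(F::nat list, G::nat list list). set F \<inter> X \<in> set ` set G})"
  unfolding independent_family_def
proof (intro allI impI)
  fix S N :: "nat set set"
  assume fin: "finite S" "finite N" and disj: "S \<inter> N = {}"
  \<comment> \<open>\<open>w X Y\<close> is a point where two distinct sets differ. With these
    points for all pairs from \<open>S \<times> N\<close> collected in \<open>F\<close>, no member
    of \<open>S\<close> has the same trace on \<open>F\<close> as a member of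
    \<open>N\<close>.\<close>
  define w where "w X Y = (SOME n::nat. (n \<in> X) \<noteq> (n \<in> Y))" for X Y
  have w: "(w X Y \<in> X) \<noteq> (w X Y \<in> Y)" if "X \<noteq> Y" for X Y
    unfolding w_def by (rule someI_ex) (use that in blast)
  obtain F where F: "set F = (\<lambda>(X, Y). w X Y) ` (S \<times> N)"
    using finite_list[of "(\<lambda>(X, Y). w X Y) ` (S \<times> N)"] fin by auto
  define l where "l X = (SOME xs. set xs = set F \<inter> X)" for X
  have l: "set (l X) = set F \<inter> X" for X
    unfolding l_def by (rule someI_ex) (simp add: finite_list)
  obtain G where G: "set G = l ` S" using finite_list[of "l ` S"] fin by auto
  have "set F \<inter> X \<in> set ` set G" if "X \<in> S" for X
    unfolding G l[symmetric] using that by blast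
  moreover have "set F \<inter> Y \<notin> set ` set G" if "Y \<in> N" for Y
  proof
    assume "set F \<inter> Y \<in> set ` set G"
    then obtain X where X: "X \<in> S" "set F \<inter> Y = set F \<inter> X" using G l by auto
    have "w X Y \<in> set F" unfolding F using X(1) that by auto
    moreover have "X \<noteq> Y" using X(1) that disj by blast
    ultimately show False using w X(2) by blast
  qed
  ultimately show "\<exists>x. (\<forall>X\<in>S. x \<in> {(F, G). set F \<inter> X \<in> set ` set G}) \<and>
      (\<forall>X\<in>N. x \<notin> {(F, G). set F \<inter> X \<in> set ` set G})"
    by (intro exI[of _ "(F, G)"]) auto
qed

lemma independent_family_vimage:
  assumes "independent_family C" "surj f"
  shows "independent_family (\<lambda>i. f -` C i)"
  unfolding independent_family_def
proof (intro allI impI)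
  fix S N :: "'a set" assume "finite S" "finite N" "S \<inter> N = {}"
  then obtain y where "\<forall>i\<in>S. y \<in> C i" "\<forall>i\<in>N. y \<notin> C i"
    using independent_familyD[OF assms(1)] by blast
  moreover obtain x where "y = f x" using assms(2) by blast
  ultimately show "\<exists>x. (\<forall>i\<in>S. x \<in> f -` C i) \<and> (\<forall>i\<in>N. x \<notin> f -` C i)" by auto
qed

text \<open>A rational shifted by an irrational is never an integer, so the floor is locally
  constant in \<open>q\<close> and preimages of arbitrary sets of integers are open.\<close>

lemma qopen_floor_vimage:
  fixes r :: real
  assumes r: "r \<notin> \<rat>"
  shows "qopen ((\<lambda>q::rat. \<lfloor>of_rat q + r\<rfloor>) -` S)"
proof -
  have rat: "of_rat q + r \<notin> \<int>" for q :: rat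
  proof
    assume "of_rat q + r \<in> \<int>"
    then have "of_rat q + r - of_rat q \<in> \<rat>" using Ints_subset_Rats Rats_diff Rats_of_rat by blast
    then show False using r by simp
  qed
  have "(\<lambda>q::rat. \<lfloor>of_rat q + r\<rfloor>) -` S =
      of_rat -` (\<Union>n\<in>S. {of_int n - r <..< of_int n + 1 - r})"
  proof (intro Set.set_eqI iffI)
    fix q :: rat assume q: "q \<in> (\<lambda>q::rat. \<lfloor>of_rat q + r\<rfloor>) -` S"
    have "of_int \<lfloor>of_rat q + r\<rfloor> \<noteq> of_rat q + r" using rat[of q] by (metis Ints_of_int)
    then have "of_int \<lfloor>of_rat q + r\<rfloor> - r < of_rat q" "of_rat q < of_int \<lfloor>of_rat q + r\<rfloor> + 1 - r"
      using floor_correct[of "of_rat q + r"] by linarith+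
    then show "q \<in> of_rat -` (\<Union>n\<in>S. {of_int n - r <..< of_int n + 1 - r})"
      using q by (auto intro!: bexI[of _ "\<lfloor>of_rat q + r\<rfloor>"])
  next
    fix q :: rat assume "q \<in> of_rat -` (\<Union>n\<in>S. {of_int n - r <..< of_int n + 1 - r})"
    then obtain n where "n \<in> S" "of_int n \<le> of_rat q + r" "of_rat q + r < of_int n + 1" by auto
    moreover from this have "\<lfloor>of_rat q + r\<rfloor> = n" by (simp add: floor_unique)
    ultimately show "q \<in> (\<lambda>q::rat. \<lfloor>of_rat q + r\<rfloor>) -` S" by simp
  qed
  then show ?thesis unfolding rat_topology_def openin_pullback_topology
    by (auto intro!: exI[of _ "\<Union>n\<in>S. {of_int n - r <..< of_int n + 1 - r}"])
qed

lemma independent_clopen_family: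
  obtains C :: "nat set \<Rightarrow> rat set" where "independent_family C" "\<And>X. qclopen (C X)"
proof -
  obtain r :: real where r: "r \<notin> \<rat>" "0 < r" "r < 1" using irrational_between[of 0 1] by auto
  \<comment> \<open>A continuous map onto the discrete integers; since \<open>r\<close> lies between
    0 and 1, it fixes every integer.\<close>
  define \<pi> where "\<pi> = (\<lambda>q::rat. \<lfloor>of_rat q + r\<rfloor>)"
  \<comment> \<open>All negative integers receive the code with index 0; the nonnegative ones
    already give surjectivity.\<close>
  define \<phi> :: "int \<Rightarrow> nat list \<times> nat list list" where "\<phi> n = from_nat (nat n)" for n
  have "surj \<pi>"
  proof (rule surjI)
    fix n :: int
    show "\<pi> (of_int n) = n" unfolding \<pi>_def by (rule floor_unique) (use r in auto)
  qed
  moreover have "surj \<phi>"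
    by (rule surjI[of _ "\<lambda>x. int (to_nat x)"]) (simp add: \<phi>_def)
  ultimately have "surj (\<phi> \<circ> \<pi>)" using comp_surj by blast
  show ?thesis
  proof (rule that[OF independent_family_vimage[OF independent_family_codes \<open>surj (\<phi> \<circ> \<pi>)\<close>]])
    have "qopen (\<pi> -` S)" for S unfolding \<pi>_def by (rule qopen_floor_vimage[OF r(1)])
    then show "qclopen ((\<phi> \<circ> \<pi>) -` {(F, G). set F \<inter> X \<in> set ` set G})" for X :: "nat set"
      unfolding vimage_comp[symmetric] vimage_Compl[symmetric] by blast
  qed
qed

subsection \<open>Counting\<close>

text \<open>The elements of \<open>UNIV :: nat set set\<close> are sets of naturals, so its size is
  the continuum; one further \<open>set\<close> in the type gives the power set of the
  continuum.\<close>

lemma continuum_clopen_partitions: "(UNIV :: nat set set) \<lesssim> clopen_partitions"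
proof -
  obtain C :: "nat set \<Rightarrow> rat set" where C: "independent_family C" "\<And>X. qclopen (C X)"
    using independent_clopen_family by metis
  have ne: "C X \<noteq> {}" for X using independent_familyD[OF C(1), of "{X}" "{}"] by auto
  have nU: "C X \<noteq> UNIV" for X using independent_familyD[OF C(1), of "{}" "{X}"] by auto
  have "inj (\<lambda>X. {C X, - C X})"
  proof (rule injI, rule ccontr)
    fix X Y assume eq: "{C X, - C X} = {C Y, - C Y}" and XY: "X \<noteq> Y"
    \<comment> \<open>The point \<open>x\<close> rules out that the two sets are equal, the point
      \<open>y\<close> below that they are complementary.\<close>
    obtain x where "x \<in> C X" "x \<notin> C Y"
      using independent_familyD[OF C(1), of "{X}" "{Y}"] XY by auto
    moreover obtain y where "y \<in> C X" "y \<in> C Y"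
      using independent_familyD[OF C(1), of "{X, Y}" "{}"] by auto
    moreover have "C X = C Y \<or> C X = - C Y" using eq unfolding doubleton_eq_iff by blast
    ultimately show False by blast
  qed
  moreover have "{C X, - C X} \<in> clopen_partitions" for X
    unfolding clopen_partitions_def using C(2)[of X] ne[of X] nU[of X] by auto
  then have "range (\<lambda>X. {C X, - C X}) \<subseteq> clopen_partitions" by auto
  ultimately show ?thesis unfolding lepoll_def by blast
qed

text \<open>Pospisil's argument: prescribing which members of an independent family belong to
  an ultrafilter is always consistent.\<close>

lemma many_clopen_ultrafilters: "(UNIV :: nat set set set) \<lesssim> clopen_ultrafilters"
proof -
  obtain C :: "nat set \<Rightarrow> rat set" where C: "independent_family C" "\<And>X. qclopen (C X)"
    using independent_clopen_family by metis
  have "\<exists>p\<in>clopen_ultrafilters. (\<forall>X\<in>\<S>. C X \<in> p) \<and> (\<forall>X. X \<notin> \<S> \<longrightarrow> - C X \<in> p)" for \<S>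
  proof -
    define F where "F = (\<lambda>X. if X \<in> \<S> then C X else - C X) ` UNIV"
    have "fip F" unfolding fip_def
    proof (intro allI impI)
      fix Z assume Z: "Z \<subseteq> F" "finite Z"
      obtain I where I: "finite I" "Z = (\<lambda>X. if X \<in> \<S> then C X else - C X) ` I"
        using finite_subset_image[OF Z(2) Z(1)[unfolded F_def]] by auto
      obtain x where "\<forall>X\<in>I \<inter> \<S>. x \<in> C X" "\<forall>X\<in>I - \<S>. x \<notin> C X"
        using independent_familyD[OF C(1), of "I \<inter> \<S>" "I - \<S>"] I(1) by blast
      then have "x \<in> \<Inter>Z" unfolding I(2) by auto
      then show "\<Inter>Z \<noteq> {}" by blast
    qed
    then obtain u where u: "F \<subseteq> u" "fip u" "\<And>A. A \<in> u \<or> - A \<in> u"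
      using fip_extend_maximal[of F] by metis
    \<comment> \<open>The extension \<open>u\<close> decides arbitrary sets; its clopen members form
      the desired ultrafilter.\<close>
    define p where "p = {A \<in> u. qclopen A}"
    have "p \<subseteq> u" by (auto simp: p_def)
    then have "fip p" using u(2) unfolding fip_def by (meson order_trans)
    then have "p \<in> clopen_ultrafilters" using u(3) unfolding clopen_ultrafilters_def by (simp add: p_def)
    moreover have mem: "(if X \<in> \<S> then C X else - C X) \<in> p" for X
    proof -
      have "(if X \<in> \<S> then C X else - C X) \<in> u" using u(1) unfolding F_def by blast
      then show ?thesis using C(2)[of X] by (simp add: p_def)
    qed
    moreover have "C X \<in> p" if "X \<in> \<S>" for X using that mem[of X] by simp
    moreover have "- C X \<in> p" if "X \<notin> \<S>" for X using that mem[of X] by simp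
    ultimately show ?thesis by (intro bexI[of _ p]) auto
  qed
  then obtain p where p: "\<And>\<S>. p \<S> \<in> clopen_ultrafilters" "\<And>\<S> X. X \<in> \<S> \<Longrightarrow> C X \<in> p \<S>"
      "\<And>\<S> X. X \<notin> \<S> \<Longrightarrow> - C X \<in> p \<S>" by metis
  have "inj p"
  proof (rule injI, rule Set.set_eqI)
    fix \<S> \<S>' X assume eq: "p \<S> = p \<S>'"
    have "\<not> (C X \<in> p \<S> \<and> - C X \<in> p \<S>)"
      using clopen_ultrafilter_disjoint[OF p(1), of "C X" \<S> "- C X"] by blast
    then show "X \<in> \<S> \<longleftrightarrow> X \<in> \<S>'"
      using p(2)[of X \<S>] p(2)[of X \<S>'] p(3)[of X \<S>] p(3)[of X \<S>'] unfolding eq by blast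
  qed
  moreover have "range p \<subseteq> clopen_ultrafilters" using p(1) by auto
  ultimately show ?thesis unfolding lepoll_def by blast
qed

text \<open>A map of the rationals is determined by its graph, which is coded as a set of naturals.
  So there are at most continuum many maps.\<close>

lemma sets_of_rat_functions_lepoll: "(A :: (rat \<Rightarrow> rat) set set) \<lesssim> (UNIV :: nat set set set)"
proof -
  define e :: "(rat \<Rightarrow> rat) \<Rightarrow> nat set" where "e f = range (\<lambda>x. to_nat (x, f x))" for f
  have "inj e"
  proof (rule injI, rule ext)
    fix f g x assume "e f = e g"
    then have "to_nat (x, f x) \<in> e g" by (auto simp: e_def)
    then show "f x = g x" by (auto simp: e_def)
  qed
  then have "inj_on ((`) e) A" by (meson inj_image_eq_iff inj_onI)
  then show ?thesis unfolding lepoll_def by blast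
qed

theorem theorem2p13:
  fixes T :: "(rat \<Rightarrow> rat) topology"
  assumes "group_topology Homeo_Q T"
    and "continuous_map (prod_topology rat_topology T) rat_topology (\<lambda>(q, h). h q)"
  shows "(UNIV :: nat set set) \<lesssim> {M. maximal_subgroup M Homeo_Q \<and> openin T M} \<and>
         {M. maximal_subgroup M Homeo_Q \<and> closedin T M} \<approx> (UNIV :: nat set set set)"
proof
  have T: "admissible T" using assms by (simp add: admissible_def)
  have "clopen_partitions \<lesssim> {M. maximal_subgroup M Homeo_Q \<and> openin T M}"
    unfolding lepoll_def using partition_stab_maximal openin_partition_stab[OF T] by blast
  with continuum_clopen_partitions
  show "(UNIV :: nat set set) \<lesssim> {M. maximal_subgroup M Homeo_Q \<and> openin T M}" by (rule lepoll_trans)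
  have "closedin T (family_stab p)" if "p \<in> clopen_ultrafilters" for p
    using that by (intro closedin_family_stab[OF T]) (rule clopen_ultrafiltersD(1))
  then have "clopen_ultrafilters \<lesssim> {M. maximal_subgroup M Homeo_Q \<and> closedin T M}"
    unfolding lepoll_def using ultrafilter_stab_maximal by blast
  with many_clopen_ultrafilters
  have "(UNIV :: nat set set set) \<lesssim> {M. maximal_subgroup M Homeo_Q \<and> closedin T M}" by (rule lepoll_trans)
  \<comment> \<open>The upper bound counts all sets of maps, and Cantor-Schroeder-Bernstein combines
    the two injections.\<close>
  with sets_of_rat_functions_lepoll
  show "{M. maximal_subgroup M Homeo_Q \<and> closedin T M} \<approx> (UNIV :: nat set set set)"
    by (rule lepoll_antisym)
qed

end
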